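(* Let $\mathsf{N},\mathsf{T},\mathsf{M}$ be positive integers with $\mathsf{N}=\mathsf{T}+1$ and $\mathsf{N}<\mathsf{M}$, and let $\eta>0$. For any $\epsilon>0$ and $\xi>0$ there exists a coding scheme $\mathcal{C}(\mathsf{N},\mathsf{T},\mathsf{M},\eta)$ that satisfies $\mathsf{T}$-node $\epsilon$-DP and has $$\mathtt{LMSE}(\mathcal{C})\le\eta^{\mathsf{M}}\,\frac{(1+\mathtt{SNR}^*(\epsilon))^{\mathsf{M}}-\mathsf{M}\,\mathtt{SNR}^*(\epsilon)^{\mathsf{M}-1}-\mathtt{SNR}^*(\epsilon)^{\mathsf{M}}}{(1+\mathtt{SNR}^*(\epsilon))^{\mathsf{M}}}+\xi.$$
   Context: Setting (distributed secure multiplication). There are $\mathsf{N}$ nodes and $\mathsf{M}$ real-valued inputs $A_1,\dots,A_{\mathsf{M}}$, which are mutually independent, have zero mean, and satisfy $\mathrm{Var}(A_i)\le\eta$. A coding scheme $\mathcal{C}(\mathsf{N},\mathsf{T},\mathsf{M},\eta)$ consists of (i) a joint distribution of real zero-mean noise variables $\{\tilde R_i^{(j)}\}_{i\in[\mathsf{M}],j\in[\mathsf{N}]}$, independent of the inputs, such that the families $\{\tilde R_1^{(j)}\}_{j},\dots,\{\tilde R_{\mathsf{M}}^{(j)}\}_{j}$ are mutually independent; and (ii) real decoding coefficients $d_1,\dots,d_{\mathsf{N}}$ (which may be chosen knowing the noise distribution and $\mathsf{N},\mathsf{T},\mathsf{M},\eta$). Node $j$ stores $\tilde A_i^{(j)}=A_i+\tilde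 R_i^{(j)}$ for $i\in[\mathsf{M}]$ and outputs $\tilde V^{(j)}=\prod_{i=1}^{\mathsf{M}}(A_i+\tilde R_i^{(j)})$; the decoder outputs $\tilde V=\sum_{j=1}^{\mathsf{N}} d_j\tilde V^{(j)}$. $\mathsf{T}$-node $\epsilon$-DP: for each $i\in[\mathsf{M}]$, all $a_0,a_1\in\mathbb{R}$ with $|a_0-a_1|\le1$, every $\mathcal{T}=\{t_1,\dots,t_{\mathsf{T}}\}\subseteq[\mathsf{N}]$ with $|\mathcal{T}|=\mathsf{T}$ and every Borel set $\mathcal{B}\subseteq\mathbb{R}^{\mathsf{T}}$, $\mathbb{P}\big((a_0+\tilde R_i^{(t_1)},\dots,a_0+\tilde R_i^{(t_{\mathsf{T}})})\in\mathcal{B}\big)\le e^{\epsilon}\,\mathbb{P}\big((a_1+\tilde R_i^{(t_1)},\dots,a_1+\tilde R_i^{(t_{\mathsf{T}})})\in\mathcal{B}\big)$. $\mathtt{LMSE}(\mathcal{C})=\sup \mathbb{E}\big[|\tilde V-\prod_{i=1}^{\mathsf{M}}A_i|^2\big]$, the supremum over all joint laws of $(A_1,\dots,A_{\mathsf{M}})$ with mutually independent zero-mean components of variance at most $\eta$; expectation over inputs and noise. Notation: $\mathtt{SNR}^*(\epsilon)=\eta/\sigma^*(\epsilon)^2$, where $\sigma^*(\epsilon)^2=\dfrac{2^{2/3}e^{-2\epsilon/3}(1+e^{-2\epsilon/3})+e^{-\epsilon}}{(1-e^{-\epsilon})^2}$. *)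

theory Defs
  imports "HOL-Probability.Probability"
begin

text \<open>Nodes are indexed by j in {..<N}, inputs by i in {..<M}.
  The law of the noise family i, i.e. of the vector (R_i^(j))_{j<N}, is the measure mu i
  on the product space noise_space N.  Mutual independence of the M noise families,
  of the M inputs, and of inputs versus noise is encoded by taking the product measure
  of the marginal laws.\<close>

definition noise_space :: "nat \<Rightarrow> (nat \<Rightarrow> real) measure" where
  "noise_space N = PiM {..<N} (\<lambda>_. borel)"

definition valid_noise :: "nat \<Rightarrow> nat \<Rightarrow> (nat \<Rightarrow> (nat \<Rightarrow> real) measure) \<Rightarrow> bool" where
  "valid_noise N M \<mu> \<longleftrightarrow>
     (\<forall>i<M. prob_space (\<mu> i) \<and> sets (\<mu> i) = sets (noise_space N) \<and>
        (\<forall>j<N. integrable (\<mu> i) (\<lambda>x. x j) \<and> (\<integral>x. x j \<partial>\<mu> i) = 0))"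

definition valid_input :: "real \<Rightarrow> real measure \<Rightarrow> bool" where
  "valid_input \<eta> \<nu> \<longleftrightarrow>
     prob_space \<nu> \<and> sets \<nu> = sets borel \<and> integrable \<nu> (\<lambda>x. x) \<and>
     integrable \<nu> (\<lambda>x. x ^ 2) \<and> (\<integral>x. x \<partial>\<nu>) = 0 \<and> (\<integral>x. x ^ 2 \<partial>\<nu>) \<le> \<eta>"

definition T_node_DP ::
  "nat \<Rightarrow> nat \<Rightarrow> nat \<Rightarrow> real \<Rightarrow> (nat \<Rightarrow> (nat \<Rightarrow> real) measure) \<Rightarrow> bool" where
  "T_node_DP N T M \<epsilon> \<mu> \<longleftrightarrow>
     (\<forall>i<M. \<forall>a0 a1 :: real. \<bar>a0 - a1\<bar> \<le> 1 \<longrightarrow>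
        (\<forall>S. S \<subseteq> {..<N} \<and> card S = T \<longrightarrow>
          (\<forall>B \<in> sets (PiM S (\<lambda>_. borel)).
             measure (\<mu> i) {x \<in> space (\<mu> i). (\<lambda>j\<in>S. a0 + x j) \<in> B}
               \<le> exp \<epsilon> * measure (\<mu> i) {x \<in> space (\<mu> i). (\<lambda>j\<in>S. a1 + x j) \<in> B})))"

text \<open>Outcome omega i = (A_i, (R_i^(j))_j).  Squared error of decoder output.\<close>
definition sq_error :: "nat \<Rightarrow> nat \<Rightarrow> (nat \<Rightarrow> real) \<Rightarrow> (nat \<Rightarrow> real \<times> (nat \<Rightarrow> real)) \<Rightarrow> real" where
  "sq_error N M d \<omega> =
     ((\<Sum>j<N. d j * (\<Prod>i<M. fst (\<omega> i) + snd (\<omega> i) j)) - (\<Prod>i<M. fst (\<omega> i))) ^ 2"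

definition LMSE ::
  "nat \<Rightarrow> nat \<Rightarrow> real \<Rightarrow> (nat \<Rightarrow> (nat \<Rightarrow> real) measure) \<Rightarrow> (nat \<Rightarrow> real) \<Rightarrow> ennreal" where
  "LMSE N M \<eta> \<mu> d =
     (SUP \<nu> \<in> {\<nu>. \<forall>i<M. valid_input \<eta> (\<nu> i)}.
        \<integral>\<^sup>+ \<omega>. ennreal (sq_error N M d \<omega>) \<partial>(PiM {..<M} (\<lambda>i. \<nu> i \<Otimes>\<^sub>M \<mu> i)))"

definition sigma_star_sq :: "real \<Rightarrow> real" where
  "sigma_star_sq \<epsilon> =
     (2 powr (2/3) * exp (-2*\<epsilon>/3) * (1 + exp (-2*\<epsilon>/3)) + exp (-\<epsilon>)) / (1 - exp (-\<epsilon>))^2"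

definition SNR_star :: "real \<Rightarrow> real \<Rightarrow> real" where
  "SNR_star \<eta> \<epsilon> = \<eta> / sigma_star_sq \<epsilon>"

end

theory Submission
  imports Defs
begin

text \<open>
  Node \<open>0\<close> uses a noise \<open>z\<^sub>0\<close> with the privacy of the staircase mechanism, node \<open>0 < j < T\<close> uses
  \<open>z\<^sub>0 + \<delta> z\<^sub>j\<close> and node \<open>T\<close> uses \<open>(1 + \<delta>) z\<^sub>0 - \<delta> \<Sum> z\<^sub>m\<close>, with independent auxiliary noises
  \<open>z\<^sub>1, \<dots>, z\<^bsub>T-1\<^esub>\<close>. For any \<open>T\<close> nodes, changing the secret by \<open>c\<close> has the same effect as
  shifting the vector \<open>z\<close> by \<open>c v\<close> for some \<open>v\<close> in the unit cube, so the privacy losses of the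
  \<open>z\<^sub>m\<close> add up, and those of the auxiliary noises can be made arbitrarily small.

  As \<open>\<delta>\<close> tends to \<open>0\<close>, the linear combinations of the node outputs approximate those of
  \<open>\<Prod>X\<^sub>i\<close> and \<open>\<Sum>\<^sub>i z\<^sub>0\<^sub>i \<Prod>\<^bsub>k \<noteq> i\<^esub> X\<^sub>k\<close>, where \<open>X\<^sub>i = A\<^sub>i + z\<^sub>0\<^sub>i\<close>; the auxiliary noises cancel to
  first order. With \<open>r = SNR / (1 + SNR)\<close>, the part of \<open>\<Prod>A\<^sub>i\<close> in their span has the fraction
  \<open>r\<^sup>M + M r\<^bsup>M-1\<^esup> (1 - r)\<close> of its energy. For fixed coefficients the error is monotone in the
  variances of the inputs, so the worst case is that all of them equal \<open>\<eta>\<close>.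
\<close>

section \<open>Staircase noise\<close>

text \<open>For nonnegative \<gamma>, level 0 is the interval from -\<gamma> to \<gamma>, where
  \<open>nat\<close> cuts the ceiling off at 0, and each further level adds a unit step on both
  sides. The staircase density is proportional to \<open>b ^ stair_level \<gamma> x\<close>.\<close>

definition stair_level :: "real \<Rightarrow> real \<Rightarrow> nat" where
  "stair_level \<gamma> x = nat \<lceil>\<bar>x\<bar> - \<gamma>\<rceil>"

lemma measurable_stair_level [measurable]: "stair_level \<gamma> \<in> borel \<rightarrow>\<^sub>M count_space UNIV"
  unfolding stair_level_def by measurable

lemma stair_level_uminus: "stair_level \<gamma> (- x) = stair_level \<gamma> x"
  by (simp add: stair_level_def)

lemma stair_level_le_iff: "0 \<le> \<gamma> \<Longrightarrow> stair_level \<gamma> x \<le> k \<longleftrightarrow> x \<in> {- (real k + \<gamma>)..real k + \<gamma>}"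
  unfolding stair_level_def by (auto simp: nat_le_iff ceiling_le_iff abs_le_iff)

text \<open>The source of privacy: a move by at most 1 climbs at most one step, so
  \<open>b ^ stair_level \<gamma> x\<close> loses at most one factor \<open>b\<close>.\<close>

lemma stair_level_shift:
  assumes "\<bar>t\<bar> \<le> 1"
  shows "stair_level \<gamma> (x + t) \<le> Suc (stair_level \<gamma> x)"
proof -
  have "\<bar>x + t\<bar> - \<gamma> \<le> (\<bar>x\<bar> - \<gamma>) + 1" using assms by linarith
  hence "\<lceil>\<bar>x + t\<bar> - \<gamma>\<rceil> \<le> \<lceil>\<bar>x\<bar> - \<gamma>\<rceil> + 1"
    by (metis ceiling_add_one ceiling_mono)
  thus ?thesis unfolding stair_level_def by linarith
qed

section \<open>Moments of the staircase profile\<close>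

lemma power_tail_sums:
  fixes b :: real
  assumes "0 \<le> b" "b < 1"
  shows "(\<lambda>k. (1 - b) * (if n \<le> k then b ^ k else 0)) sums b ^ n"
proof -
  have "(\<lambda>k. if k \<in> {..<n} then - (b ^ k) else 0) sums (\<Sum>k<n. - (b ^ k))"
    by (rule sums_If_finite_set) simp
  hence "(\<lambda>k. if n \<le> k then 0 else - (b ^ k)) sums (\<Sum>k<n. - (b ^ k))"
    by (rule sums_cong[THEN iffD1, rotated]) auto
  from sums_add[OF geometric_sums[of b] this] assms
  have "(\<lambda>k. if n \<le> k then b ^ k else 0) sums (1 / (1 - b) + (\<Sum>k<n. - (b ^ k)))"
    by (simp add: if_distrib cong: if_cong)
  moreover have "(1 - b) * (1 / (1 - b) + (\<Sum>k<n. - (b ^ k))) = b ^ n"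
    using assms by (simp add: sum_negf sum_gp_strict field_simps)
  ultimately show ?thesis
    using sums_mult[of _ _ "1 - b"] by metis
qed

text \<open>Layer-cake form: \<open>b ^ n\<close> is the tail of a geometric series, so the profile
  is a mixture of indicators of symmetric intervals and its moments reduce to integrals over
  those.\<close>

lemma power_stair_level_eq_suminf:
  fixes b :: real
  assumes "0 \<le> b" "b < 1" "0 \<le> \<gamma>"
  shows "ennreal (b ^ stair_level \<gamma> x) =
    (\<Sum>k. ennreal ((1 - b) * b ^ k) * indicator {- (real k + \<gamma>)..real k + \<gamma>} x)"
proof -
  have "ennreal (b ^ stair_level \<gamma> x) =
      (\<Sum>k. ennreal ((1 - b) * (if stair_level \<gamma> x \<le> k then b ^ k else 0)))"
    using assms by (intro suminf_ennreal_eq[symmetric] power_tail_sums) auto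
  also have "\<dots> = (\<Sum>k. ennreal ((1 - b) * b ^ k) * indicator {- (real k + \<gamma>)..real k + \<gamma>} x)"
    using assms by (intro suminf_cong) (auto simp: stair_level_le_iff indicator_def)
  finally show ?thesis .
qed

lemma nn_integral_even_power_symmetric:
  assumes "0 \<le> c" "even p"
  shows "(\<integral>\<^sup>+x. ennreal (x ^ p) * indicator {- c..c} x \<partial>lborel) = ennreal (2 * c ^ Suc p / real (Suc p))"
proof -
  have deriv: "((\<lambda>x. x ^ Suc p / real (Suc p)) has_real_derivative x ^ p) (at x)" for x
    using DERIV_cdivide[OF DERIV_pow[of "Suc p" x], of "real (Suc p)"] by simp
  have "(\<integral>\<^sup>+x. ennreal (x ^ p) * indicator {- c..c} x \<partial>lborel) =
      ennreal (c ^ Suc p / real (Suc p) - (- c) ^ Suc p / real (Suc p))"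
    using assms by (intro nn_integral_FTC_Icc)
      (auto intro!: deriv simp: zero_le_even_power simp del: power_Suc of_nat_Suc)
  also have "c ^ Suc p / real (Suc p) - (- c) ^ Suc p / real (Suc p) = 2 * c ^ Suc p / real (Suc p)"
    using \<open>even p\<close> by simp
  finally show ?thesis .
qed

lemma nn_integral_even_power_staircase:
  fixes b :: real
  assumes b: "0 \<le> b" "b < 1" and "0 \<le> \<gamma>" "even p"
    and s: "(\<lambda>k. (real k + \<gamma>) ^ Suc p * b ^ k) sums s"
  shows "(\<integral>\<^sup>+x. ennreal (x ^ p * b ^ stair_level \<gamma> x) \<partial>lborel) =
    ennreal (2 * (1 - b) / real (Suc p) * s)"
proof -
  have "(\<integral>\<^sup>+x. ennreal (x ^ p * b ^ stair_level \<gamma> x) \<partial>lborel) =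
     (\<integral>\<^sup>+x. (\<Sum>k. ennreal ((1 - b) * b ^ k) *
        (ennreal (x ^ p) * indicator {- (real k + \<gamma>)..real k + \<gamma>} x)) \<partial>lborel)"
    using assms
    by (intro nn_integral_cong)
       (simp add: ennreal_mult' ennreal_mult'' power_stair_level_eq_suminf zero_le_even_power
          flip: ennreal_suminf_cmult, simp add: mult_ac)
  also have "\<dots> = (\<Sum>k. ennreal ((1 - b) * b ^ k) * ennreal (2 * (real k + \<gamma>) ^ Suc p / real (Suc p)))"
    using assms by (simp add: nn_integral_suminf nn_integral_cmult nn_integral_even_power_symmetric
        del: power_Suc of_nat_Suc minus_add_distrib)
  also have "\<dots> = (\<Sum>k. ennreal (2 * (1 - b) / real (Suc p) * ((real k + \<gamma>) ^ Suc p * b ^ k)))"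
    using assms by (intro suminf_cong) (simp add: ennreal_mult'[symmetric] mult_ac del: power_Suc of_nat_Suc)
  also have "\<dots> = ennreal (2 * (1 - b) / real (Suc p) * s)"
    using assms by (intro suminf_ennreal_eq sums_mult) auto
  finally show ?thesis .
qed

text \<open>Both sums telescope: \<open>p\<close> and \<open>q\<close> are the polynomials with
  \<open>p x - b * p (x + 1) = x\<close> and \<open>q x - b * q (x + 1) = x ^ 3\<close>, and the
  boundary terms vanish because \<open>b ^ k\<close> beats every power of \<open>k\<close>.\<close>

lemma shifted_geometric_moment_sums:
  fixes b g :: real
  assumes b: "0 < b" "b < 1"
  shows "(\<lambda>k. (real k + g) * b ^ k) sums ((b + g * (1 - b)) / (1 - b) ^ 2)"
    and "(\<lambda>k. (real k + g) ^ 3 * b ^ k) sums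
      (let y = b + g * (1 - b) in (y ^ 3 + 3 * b * y + b + b ^ 2) / (1 - b) ^ 4)"
proof -
  have lim: "(\<lambda>k. real k ^ n * b ^ k) \<longlonglongrightarrow> 0" for n
  proof (cases n)
    case 0
    thus ?thesis using b by (simp add: LIMSEQ_realpow_zero)
  next
    case (Suc m)
    \<comment> \<open>\<open>real k ^ n * b ^ k\<close> is the \<open>n\<close>-th power of
      \<open>real k * root n b ^ k\<close>, which reduces to the linear case.\<close>
    have r: "0 < root n b" "root n b < 1" using b Suc by auto
    have "(\<lambda>k. (real k * root n b ^ k) ^ n) \<longlonglongrightarrow> 0 ^ n"
      using r by (intro tendsto_power powser_times_n_limit_0) auto
    also have "(\<lambda>k. (real k * root n b ^ k) ^ n) = (\<lambda>k. real k ^ n * b ^ k)"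
    proof
      fix k
      have "(root n b ^ k) ^ n = (root n b ^ n) ^ k" by (simp add: mult.commute flip: power_mult)
      thus "(real k * root n b ^ k) ^ n = real k ^ n * b ^ k"
        using b Suc by (simp add: power_mult_distrib real_root_pow_pos del: power_Suc)
    qed
    finally show ?thesis using Suc by simp
  qed
  \<comment> \<open>With \<open>b = 1 - d\<close> every denominator is a power of the single
    variable \<open>d\<close>.\<close>
  obtain d where d: "b = 1 - d" "d \<noteq> 0" 
    using b that[of "1 - b"] by simp
  define p :: "real \<Rightarrow> real" where "p x = x / (1 - b) + b / (1 - b) ^ 2" for x
  have "(\<lambda>k. real k ^ 1 * b ^ k / (1 - b) + (g / (1 - b) + b / (1 - b) ^ 2) * (real k ^ 0 * b ^ k))
      \<longlonglongrightarrow> 0 / (1 - b) + (g / (1 - b) + b / (1 - b) ^ 2) * 0"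
    using b by (intro tendsto_intros lim) auto
  hence p_lim: "(\<lambda>k. p (real k + g) * b ^ k) \<longlonglongrightarrow> 0"
    by (simp add: p_def algebra_simps add_divide_distrib)
  have p_step: "p x - b * p (x + 1) = x" for x
    unfolding p_def using d(2) by (simp add: d(1) divide_simps) algebra
  from telescope_sums'[OF p_lim]
  have "(\<lambda>k. p (real k + g) * b ^ k - p (real (Suc k) + g) * b ^ Suc k) sums p g" by simp
  moreover have "p (real k + g) * b ^ k - p (real (Suc k) + g) * b ^ Suc k = (real k + g) * b ^ k" for k
  proof -
    have "p (real k + g) * b ^ k - p (real (Suc k) + g) * b ^ Suc k =
        (p (real k + g) - b * p ((real k + g) + 1)) * b ^ k"
      by (simp add: algebra_simps)
    thus ?thesis by (simp only: p_step)
  qed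
  moreover have "p g = (b + g * (1 - b)) / (1 - b) ^ 2"
    unfolding p_def using d(2) by (simp add: d(1) divide_simps) algebra
  ultimately show "(\<lambda>k. (real k + g) * b ^ k) sums ((b + g * (1 - b)) / (1 - b) ^ 2)"
    by simp
  define q :: "real \<Rightarrow> real" where
    "q x = x ^ 3 / (1 - b) + 3 * b * x ^ 2 / (1 - b) ^ 2 + 3 * b * (1 + b) * x / (1 - b) ^ 3
       + b * (1 + 4 * b + b ^ 2) / (1 - b) ^ 4" for x
  \<comment> \<open>\<open>c1\<close> is the linear coefficient of \<open>q (x + g)\<close> as a
    polynomial in \<open>x\<close>; the constant one is \<open>q g\<close>.\<close>
  define c1 where "c1 = 3 * g ^ 2 / (1 - b) + 6 * b * g / (1 - b) ^ 2 + 3 * b * (1 + b) / (1 - b) ^ 3"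
  have "(\<lambda>k. real k ^ 3 * b ^ k / (1 - b) + (3 * g / (1 - b) + 3 * b / (1 - b) ^ 2) * (real k ^ 2 * b ^ k)
       + c1 * (real k ^ 1 * b ^ k) + q g * (real k ^ 0 * b ^ k))
      \<longlonglongrightarrow> 0 / (1 - b) + (3 * g / (1 - b) + 3 * b / (1 - b) ^ 2) * 0 + c1 * 0 + q g * 0"
    using b by (intro tendsto_intros lim) auto
  moreover have "x ^ 3 * y / (1 - b) + (3 * g / (1 - b) + 3 * b / (1 - b) ^ 2) * (x ^ 2 * y)
       + c1 * (x ^ 1 * y) + q g * (x ^ 0 * y) = q (x + g) * y" for x y
    unfolding q_def c1_def using d(2) by (simp add: d(1) divide_simps) algebra
  ultimately have q_lim: "(\<lambda>k. q (real k + g) * b ^ k) \<longlonglongrightarrow> 0"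
    by simp
  have q_step: "q x - b * q (x + 1) = x ^ 3" for x
    unfolding q_def using d(2) by (simp add: d(1) divide_simps) algebra
  from telescope_sums'[OF q_lim]
  have "(\<lambda>k. q (real k + g) * b ^ k - q (real (Suc k) + g) * b ^ Suc k) sums q g" by simp
  moreover have "q (real k + g) * b ^ k - q (real (Suc k) + g) * b ^ Suc k = (real k + g) ^ 3 * b ^ k" for k
  proof -
    have "q (real k + g) * b ^ k - q (real (Suc k) + g) * b ^ Suc k =
        (q (real k + g) - b * q ((real k + g) + 1)) * b ^ k"
      by (simp add: algebra_simps)
    thus ?thesis by (simp only: q_step)
  qed
  moreover have "q g = (let y = b + g * (1 - b) in (y ^ 3 + 3 * b * y + b + b ^ 2) / (1 - b) ^ 4)"
    unfolding q_def Let_def using d(2) by (simp add: d(1) divide_simps) algebra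
  ultimately show "(\<lambda>k. (real k + g) ^ 3 * b ^ k) sums
      (let y = b + g * (1 - b) in (y ^ 3 + 3 * b * y + b + b ^ 2) / (1 - b) ^ 4)"
    by simp
qed

section \<open>Private noise of prescribed variance\<close>

text \<open>Test functions replace events so that the bound survives Fubini: integrating out a
  coordinate turns an indicator into a general nonnegative function.\<close>

definition shift_private :: "real \<Rightarrow> real measure \<Rightarrow> bool" where
  "shift_private \<epsilon> \<rho> \<longleftrightarrow> (\<forall>h \<in> borel_measurable borel. \<forall>t. \<bar>t\<bar> \<le> 1 \<longrightarrow>
     (\<integral>\<^sup>+x. h (x + t) \<partial>\<rho>) \<le> ennreal (exp \<epsilon>) * (\<integral>\<^sup>+x. h x \<partial>\<rho>))"

text \<open>The variance of the staircase noise with steps at \<open>k + \<gamma>\<close> depends on \<open>y = b + \<gamma> (1 - b)\<close>, where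
  \<open>b = exp (- \<epsilon>)\<close>, as \<open>(y\<^sup>2 / 3 + b + b (1 + b) / (3 y)) / (1 - b)\<^sup>2\<close>. The optimal \<open>y\<close> is the cube root
  of \<open>b (1 + b) / 2\<close>, but the simpler \<open>y = exp (- \<epsilon> / 3)\<close> already stays below \<open>sigma_star_sq \<epsilon>\<close>.\<close>

lemma staircase_noise:
  fixes \<epsilon> :: real
  assumes "0 < \<epsilon>"
  defines "\<beta> \<equiv> exp (- \<epsilon> / 3)"
  obtains \<rho> where "valid_input ((\<beta> ^ 2 * (2 + \<beta> ^ 3) / 3 + \<beta> ^ 3) / (1 - \<beta> ^ 3) ^ 2) \<rho>"
    "0 < (\<integral>x. x ^ 2 \<partial>\<rho>)" "shift_private \<epsilon> \<rho>"
proof -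
  define b where "b = \<beta> ^ 3"
  \<comment> \<open>Chosen so that \<open>b + \<gamma> * (1 - b)\<close>, the \<open>y\<close> of
    the moment sums, equals \<beta>. By the first of these sums, \<open>Z\<close> below is then the
    total mass of \<open>b ^ stair_level \<gamma> x\<close>.\<close>
  define \<gamma> where "\<gamma> = (\<beta> - b) / (1 - b)"
  define Z where "Z = 2 * \<beta> / (1 - b)"
  define V where "V = (\<beta> ^ 2 * (2 + \<beta> ^ 3) / 3 + \<beta> ^ 3) / (1 - \<beta> ^ 3) ^ 2"
  have \<beta>: "0 < \<beta>" "\<beta> < 1" using assms by (auto simp: \<beta>_def)
  have b_exp: "b = exp (- \<epsilon>)"
    unfolding b_def \<beta>_def by (simp flip: exp_of_nat_mult)
  have b: "0 < b" "b < 1" using assms by (auto simp: b_exp)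
  have "b \<le> \<beta>" unfolding b_def using \<beta> power_decreasing[of 1 3 \<beta>] by simp
  hence \<gamma>: "0 \<le> \<gamma>" using b by (simp add: \<gamma>_def)
  have y: "b + \<gamma> * (1 - b) = \<beta>" using b by (simp add: \<gamma>_def)
  have Z: "0 < Z" using \<beta> b by (simp add: Z_def)
  define f where "f x = b ^ stair_level \<gamma> x / Z" for x
  have f_pos: "0 < f x" for x using b Z by (simp add: f_def)
  have f_meas [measurable]: "f \<in> borel_measurable borel" unfolding f_def by measurable
  have f_even: "f (- x) = f x" for x by (simp add: f_def stair_level_uminus)
  have f_shift: "f (x + t) \<le> exp \<epsilon> * f x" if "\<bar>t\<bar> \<le> 1" for x t
  proof -
    have "stair_level \<gamma> x \<le> Suc (stair_level \<gamma> (x + t))"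
      using stair_level_shift[of "- t" \<gamma> "x + t"] that by simp
    hence "b ^ Suc (stair_level \<gamma> (x + t)) \<le> b ^ stair_level \<gamma> x"
      using b by (intro power_decreasing) auto
    hence "b * f (x + t) \<le> f x" using Z by (simp add: f_def divide_right_mono)
    thus ?thesis by (simp add: b_exp exp_minus field_simps)
  qed
  define \<rho> where "\<rho> = density lborel (\<lambda>x. ennreal (f x))"
  have sets_\<rho> [measurable_cong, simp]: "sets \<rho> = sets borel" by (simp add: \<rho>_def)
  have moment: "(\<integral>\<^sup>+x. ennreal (x ^ p) \<partial>\<rho>) = ennreal (2 * (1 - b) / real (Suc p) * s / Z)"
    if "even p" "(\<lambda>k. (real k + \<gamma>) ^ Suc p * b ^ k) sums s" for p s
  proof -
    have "(\<integral>\<^sup>+x. ennreal (x ^ p) \<partial>\<rho>) =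
        (\<integral>\<^sup>+x. ennreal (1 / Z) * ennreal (x ^ p * b ^ stair_level \<gamma> x) \<partial>lborel)"
      unfolding \<rho>_def using that(1) f_pos Z b
      by (subst nn_integral_density)
         (auto intro!: nn_integral_cong simp: f_def ennreal_mult[symmetric] zero_le_even_power mult_ac)
    also have "\<dots> = ennreal (1 / Z) * ennreal (2 * (1 - b) / real (Suc p) * s)"
      using b \<gamma> that
      by (subst nn_integral_cmult) (measurable, subst nn_integral_even_power_staircase, auto)
    also have "\<dots> = ennreal (2 * (1 - b) / real (Suc p) * s / Z)"
      using Z by (simp add: ennreal_mult'[symmetric] mult.commute del: of_nat_Suc)
    finally show ?thesis .
  qed
  have "(\<integral>\<^sup>+x. ennreal (x ^ 0) \<partial>\<rho>) = ennreal (2 * (1 - b) / real (Suc 0) * (\<beta> / (1 - b) ^ 2) / Z)"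
    using shifted_geometric_moment_sums(1)[OF b, of \<gamma>] unfolding y by (intro moment) auto
  also have "2 * (1 - b) / real (Suc 0) * (\<beta> / (1 - b) ^ 2) / Z = 1"
    using \<beta> b by (simp add: Z_def power2_eq_square)
  finally have "emeasure \<rho> (space \<rho>) = 1" by simp
  hence prob: "prob_space \<rho>" by (rule prob_spaceI)
  interpret prob_space \<rho> by fact
  have "(\<integral>\<^sup>+x. ennreal (x ^ 2) \<partial>\<rho>) =
      ennreal (2 * (1 - b) / real (Suc 2) * ((\<beta> ^ 3 + 3 * b * \<beta> + b + b ^ 2) / (1 - b) ^ 4) / Z)"
    using shifted_geometric_moment_sums(2)[OF b, of \<gamma>] unfolding y Let_def
    by (intro moment) (auto simp: numeral_3_eq_3)
  also have "2 * (1 - b) / real (Suc 2) * ((\<beta> ^ 3 + 3 * b * \<beta> + b + b ^ 2) / (1 - b) ^ 4) / Z = V"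
  proof -
    have "\<beta> ^ 3 + 3 * b * \<beta> + b + b ^ 2 = \<beta> * (\<beta> ^ 2 * (2 + b) + 3 * b)"
      unfolding b_def by algebra
    moreover have "2 * d / 3 * (\<beta> * X / d ^ 4) / (2 * \<beta> / d) = X / 3 / d ^ 2" if "d \<noteq> 0" for d X
      using that \<beta> by (simp add: divide_simps power2_eq_square power4_eq_xxxx)
    from this[of "1 - b" "\<beta> ^ 2 * (2 + b) + 3 * b"]
    have "2 * (1 - b) / 3 * (\<beta> * (\<beta> ^ 2 * (2 + b) + 3 * b) / (1 - b) ^ 4) / (2 * \<beta> / (1 - b)) = V"
      using b unfolding V_def b_def[symmetric] by (simp add: add_divide_distrib)
    ultimately show ?thesis unfolding Z_def by simp
  qed
  finally have nn2: "(\<integral>\<^sup>+x. ennreal (x ^ 2) \<partial>\<rho>) = ennreal V" .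
  have V: "0 < V" using \<beta> b unfolding V_def b_def[symmetric] by (auto intro!: divide_pos_pos add_nonneg_pos)
  have int2: "integrable \<rho> (\<lambda>x. x ^ 2)"
    by (rule integrableI_nonneg) (auto simp: nn2)
  have V_eq: "(\<integral>x. x ^ 2 \<partial>\<rho>) = V"
    using V by (intro integral_eq_nn_integral[THEN trans]) (auto simp: nn2)
  have int1: "integrable \<rho> (\<lambda>x. x)"
    by (rule square_integrable_imp_integrable[OF _ int2]) simp
  \<comment> \<open>The density is even, so a reflection shows that the mean equals its own
    negative.\<close>
  have "(\<integral>x. x \<partial>\<rho>) = (\<integral>x. f x * x \<partial>lborel)"
    unfolding \<rho>_def using f_pos by (subst integral_density) (auto simp: less_imp_le)
  also have "\<dots> = (\<integral>x. f (- x) * (- x) \<partial>lborel)"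
    by (subst lborel_integral_real_affine[where c = "-1" and t = 0]) auto
  also have "\<dots> = - (\<integral>x. f x * x \<partial>lborel)" by (simp add: f_even)
  also have "(\<integral>x. f x * x \<partial>lborel) = (\<integral>x. x \<partial>\<rho>)"
    unfolding \<rho>_def using f_pos by (subst integral_density) (auto simp: less_imp_le)
  finally have mean: "(\<integral>x. x \<partial>\<rho>) = 0" by simp
  have "shift_private \<epsilon> \<rho>"
    unfolding shift_private_def
  proof (intro ballI allI impI)
    fix h :: "real \<Rightarrow> ennreal" and t :: real
    assume [measurable]: "h \<in> borel_measurable borel" and t: "\<bar>t\<bar> \<le> 1"
    have "(\<integral>\<^sup>+x. h (x + t) \<partial>\<rho>) = (\<integral>\<^sup>+x. ennreal (f x) * h (x + t) \<partial>lborel)"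
      unfolding \<rho>_def by (subst nn_integral_density) auto
    also have "\<dots> = (\<integral>\<^sup>+x. ennreal (f (x - t)) * h x \<partial>lborel)"
      by (subst nn_integral_real_affine[where c = 1 and t = "- t"]) auto
    also have "\<dots> \<le> (\<integral>\<^sup>+x. ennreal (exp \<epsilon>) * (ennreal (f x) * h x) \<partial>lborel)"
    proof (rule nn_integral_mono)
      fix x
      have "ennreal (f (x - t)) \<le> ennreal (exp \<epsilon>) * ennreal (f x)"
        using f_shift[of "- t" x] t by (simp add: ennreal_mult'[symmetric] ennreal_leI)
      thus "ennreal (f (x - t)) * h x \<le> ennreal (exp \<epsilon>) * (ennreal (f x) * h x)"
        unfolding mult.assoc[symmetric] by (rule mult_right_mono) simp
    qed
    also have "\<dots> = ennreal (exp \<epsilon>) * (\<integral>\<^sup>+x. h x \<partial>\<rho>)"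
      unfolding \<rho>_def by (subst nn_integral_density) (auto simp: nn_integral_cmult)
    finally show "(\<integral>\<^sup>+x. h (x + t) \<partial>\<rho>) \<le> ennreal (exp \<epsilon>) * (\<integral>\<^sup>+x. h x \<partial>\<rho>)" .
  qed
  moreover have "valid_input V \<rho>"
    unfolding valid_input_def using prob int1 int2 mean V_eq by simp
  ultimately show ?thesis using that[of \<rho>] V V_eq unfolding V_def by simp
qed

text \<open>Stretching a noise by a factor \<open>c\<close> of at least 1 keeps its privacy and
  multiplies the variance by \<open>c ^ 2\<close>, so the staircase noise can be brought to exactly
  \<open>sigma_star_sq \<epsilon>\<close>. Equality lets the limiting error agree with the stated
  formula.\<close>

lemma noise_with_sigma_star_variance:
  assumes "0 < \<epsilon>"
  obtains \<rho> where "valid_input (sigma_star_sq \<epsilon>) \<rho>" "(\<integral>x. x ^ 2 \<partial>\<rho>) = sigma_star_sq \<epsilon>"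
    "shift_private \<epsilon> \<rho>"
proof -
  define \<beta> where "\<beta> = exp (- \<epsilon> / 3)"
  obtain \<rho> where \<rho>: "valid_input ((\<beta> ^ 2 * (2 + \<beta> ^ 3) / 3 + \<beta> ^ 3) / (1 - \<beta> ^ 3) ^ 2) \<rho>"
    "0 < (\<integral>x. x ^ 2 \<partial>\<rho>)" "shift_private \<epsilon> \<rho>"
    using staircase_noise[OF assms] unfolding \<beta>_def by blast
  have \<beta>: "0 < \<beta>" "\<beta> < 1" using assms by (auto simp: \<beta>_def)
  define V where "V = (\<integral>x. x ^ 2 \<partial>\<rho>)"
  interpret prob_space \<rho> using \<rho>(1) by (simp add: valid_input_def)
  have [measurable_cong, simp]: "sets \<rho> = sets borel" using \<rho>(1) by (simp add: valid_input_def)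
  have "V \<le> (\<beta> ^ 2 * (2 + \<beta> ^ 3) / 3 + \<beta> ^ 3) / (1 - \<beta> ^ 3) ^ 2"
    using \<rho>(1) by (simp add: V_def valid_input_def)
  \<comment> \<open>The two numerators compare because \<open>(2 + \<beta> ^ 3) / 3\<close> is at
    most 1 and \<open>2 powr (2/3) * (1 + \<beta> ^ 2)\<close> is at least 1.\<close>
  also have "\<dots> \<le> (2 powr (2/3) * \<beta> ^ 2 * (1 + \<beta> ^ 2) + \<beta> ^ 3) / (1 - \<beta> ^ 3) ^ 2"
  proof (intro divide_right_mono add_right_mono)
    have "\<beta> ^ 3 \<le> 1" using \<beta> by (simp add: power_le_one)
    hence "(2 + \<beta> ^ 3) / 3 \<le> 1" by simp
    also have "1 \<le> 2 powr (2/3) * (1 + \<beta> ^ 2)"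
      using ge_one_powr_ge_zero[of 2 "2/3"] mult_mono[of 1 "2 powr (2/3)" 1 "1 + \<beta> ^ 2"] by simp
    finally have "\<beta> ^ 2 * ((2 + \<beta> ^ 3) / 3) \<le> \<beta> ^ 2 * (2 powr (2/3) * (1 + \<beta> ^ 2))"
      by (rule mult_left_mono) simp
    thus "\<beta> ^ 2 * (2 + \<beta> ^ 3) / 3 \<le> 2 powr (2/3) * \<beta> ^ 2 * (1 + \<beta> ^ 2)" by (simp add: mult_ac)
  qed simp
  also have "\<dots> = sigma_star_sq \<epsilon>"
    unfolding sigma_star_sq_def \<beta>_def by (simp flip: exp_of_nat_mult)
  finally have le: "V \<le> sigma_star_sq \<epsilon>" .
  have V: "0 < V" using \<rho>(2) by (simp add: V_def)
  define c where "c = sqrt (sigma_star_sq \<epsilon> / V)"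
  have c: "1 \<le> c" using le V by (simp add: c_def)
  have c2: "c ^ 2 * V = sigma_star_sq \<epsilon>" using le V by (simp add: c_def)
  define \<rho>' where "\<rho>' = distr \<rho> borel (\<lambda>x. c * x)"
  have int: "integrable \<rho> (\<lambda>x. x)" "integrable \<rho> (\<lambda>x. x ^ 2)" "(\<integral>x. x \<partial>\<rho>) = 0"
    using \<rho>(1) by (auto simp: valid_input_def)
  have var: "(\<integral>x. x ^ 2 \<partial>\<rho>') = sigma_star_sq \<epsilon>"
    unfolding \<rho>'_def by (subst integral_distr) (auto simp: power_mult_distrib V_def[symmetric] c2)
  moreover have "valid_input (sigma_star_sq \<epsilon>) \<rho>'"
    unfolding valid_input_def
  proof (intro conjI)
    show "prob_space \<rho>'" unfolding \<rho>'_def by (rule prob_space_distr) simp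
    have meas: "(\<lambda>x. c * x) \<in> \<rho> \<rightarrow>\<^sub>M borel" by measurable
    have "integrable \<rho> (\<lambda>x. c * x)"
      using int(1) by (rule integrable_mult_right)
    thus "integrable \<rho>' (\<lambda>x. x)"
      unfolding \<rho>'_def by (subst integrable_distr_eq[OF meas]) measurable
    have "integrable \<rho> (\<lambda>x. (c * x) ^ 2)"
      unfolding power_mult_distrib using int(2) by (rule integrable_mult_right)
    thus "integrable \<rho>' (\<lambda>x. x ^ 2)"
      unfolding \<rho>'_def by (subst integrable_distr_eq[OF meas]) measurable
    have "(\<integral>x. x \<partial>\<rho>') = (\<integral>x. c * x \<partial>\<rho>)"
      unfolding \<rho>'_def by (rule integral_distr[OF meas]) measurable
    thus "(\<integral>x. x \<partial>\<rho>') = 0" using int(3) by simp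
    show "sets \<rho>' = sets borel" by (simp add: \<rho>'_def)
  qed (simp add: var)
  moreover have "shift_private \<epsilon> \<rho>'"
    unfolding shift_private_def
  proof (intro ballI allI impI)
    fix h :: "real \<Rightarrow> ennreal" and t :: real
    assume [measurable]: "h \<in> borel_measurable borel" and t: "\<bar>t\<bar> \<le> 1"
    \<comment> \<open>Shifting \<open>c * x\<close> by \<open>t\<close> is shifting \<open>x\<close>
      by \<open>t / c\<close>, again of size at most 1.\<close>
    have "(\<integral>\<^sup>+x. h (c * (x + t / c)) \<partial>\<rho>) \<le> ennreal (exp \<epsilon>) * (\<integral>\<^sup>+x. h (c * x) \<partial>\<rho>)"
      using \<rho>(3)[unfolded shift_private_def, rule_format, of "\<lambda>x. h (c * x)" "t / c"] c t by simp
    thus "(\<integral>\<^sup>+x. h (x + t) \<partial>\<rho>') \<le> ennreal (exp \<epsilon>) * (\<integral>\<^sup>+x. h x \<partial>\<rho>')"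
      using c by (simp add: \<rho>'_def nn_integral_distr distrib_left)
  qed
  ultimately show ?thesis using that by blast
qed

section \<open>Privacy of linear noise\<close>

text \<open>Induction on the coordinates by Fubini: with the shifted others fixed, the new
  coordinate costs a factor \<open>exp (\<epsilon> i)\<close>, and the induction hypothesis applies
  to \<open>h'\<close>, the function left after integrating that coordinate out.\<close>

lemma shift_private_PiM:
  fixes \<rho> :: "nat \<Rightarrow> real measure" and t \<epsilon> :: "nat \<Rightarrow> real"
  assumes prob: "\<And>m. prob_space (\<rho> m)" and sets_\<rho>: "\<And>m. sets (\<rho> m) = sets borel"
    and priv: "\<And>m. shift_private (\<epsilon> m) (\<rho> m)"
    and "finite I" and t: "\<And>m. \<bar>t m\<bar> \<le> 1"
    and "h \<in> borel_measurable (PiM I (\<lambda>_. borel))"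
  shows "(\<integral>\<^sup>+z. h (\<lambda>m\<in>I. z m + t m) \<partial>PiM I \<rho>) \<le> ennreal (exp (\<Sum>m\<in>I. \<epsilon> m)) * (\<integral>\<^sup>+z. h z \<partial>PiM I \<rho>)"
  using \<open>finite I\<close> \<open>h \<in> _\<close>
proof (induction I arbitrary: h)
  case empty
  have "(\<integral>\<^sup>+z. h (\<lambda>m\<in>{}. z m + t m) \<partial>PiM {} \<rho>) = (\<integral>\<^sup>+z. h z \<partial>PiM {} \<rho>)"
    by (intro nn_integral_cong) (auto simp: space_PiM PiE_def extensional_def restrict_def intro!: arg_cong[where f = h])
  thus ?case by (simp only: sum.empty exp_zero ennreal_1 mult_1 order_refl)
next
  case (insert i I)
  interpret product_sigma_finite \<rho>
    using prob by (intro product_sigma_finite.intro prob_space_imp_sigma_finite)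
  have sets_PiM [measurable_cong]: "sets (PiM J \<rho>) = sets (PiM J (\<lambda>_. borel))" for J
    using sets_\<rho> by (intro sets_PiM_cong) auto
  note sets_\<rho>[measurable_cong]
  note [measurable] = insert.prems
  define h' where "h' z = (\<integral>\<^sup>+y. h (z(i := y)) \<partial>\<rho> i)" for z
  have meas_shift: "(\<lambda>z. \<lambda>m\<in>J. z m + t m) \<in> PiM J (\<lambda>_. borel) \<rightarrow>\<^sub>M PiM J (\<lambda>_. borel :: real measure)" for J
    by measurable
  have sf: "sigma_finite_measure (\<rho> i)" by (simp add: sigma_finite_measures)
  have h'_meas [measurable]: "h' \<in> borel_measurable (PiM I (\<lambda>_. borel))"
    unfolding h'_def by (intro sigma_finite_measure.borel_measurable_nn_integral[OF sf]) measurable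
  have "(\<integral>\<^sup>+z. h (\<lambda>m\<in>insert i I. z m + t m) \<partial>PiM (insert i I) \<rho>) =
      (\<integral>\<^sup>+z. \<integral>\<^sup>+y. h (\<lambda>m\<in>insert i I. (z(i := y)) m + t m) \<partial>\<rho> i \<partial>PiM I \<rho>)"
    using insert.hyps by (intro product_nn_integral_insert) measurable
  also have "\<dots> = (\<integral>\<^sup>+z. \<integral>\<^sup>+y. h ((\<lambda>m\<in>I. z m + t m)(i := y + t i)) \<partial>\<rho> i \<partial>PiM I \<rho>)"
    using insert.hyps
    by (intro nn_integral_cong arg_cong[where f = h]) (auto simp: fun_eq_iff restrict_def)
  also have "\<dots> \<le> (\<integral>\<^sup>+z. ennreal (exp (\<epsilon> i)) * h' (\<lambda>m\<in>I. z m + t m) \<partial>PiM I \<rho>)"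
    unfolding h'_def
  proof (intro nn_integral_mono)
    fix z
    have "(\<lambda>m\<in>I. z m + t m) \<in> space (PiM I (\<lambda>_. borel))" by (simp add: space_PiM)
    hence "(\<lambda>y. h ((\<lambda>m\<in>I. z m + t m)(i := y))) \<in> borel_measurable borel"
      using insert.hyps by (intro measurable_compose[OF _ insert.prems] measurable_fun_upd) (auto intro: measurable_const)
    from priv[of i, unfolded shift_private_def, rule_format, OF this t[of i]]
    show "(\<integral>\<^sup>+y. h ((\<lambda>m\<in>I. z m + t m)(i := y + t i)) \<partial>\<rho> i) \<le>
        ennreal (exp (\<epsilon> i)) * (\<integral>\<^sup>+y. h ((\<lambda>m\<in>I. z m + t m)(i := y)) \<partial>\<rho> i)" .
  qed
  also have "\<dots> = ennreal (exp (\<epsilon> i)) * (\<integral>\<^sup>+z. h' (\<lambda>m\<in>I. z m + t m) \<partial>PiM I \<rho>)"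
    by (intro nn_integral_cmult) measurable
  also have "\<dots> \<le> ennreal (exp (\<epsilon> i)) * (ennreal (exp (\<Sum>m\<in>I. \<epsilon> m)) * (\<integral>\<^sup>+z. h' z \<partial>PiM I \<rho>))"
    by (intro mult_left_mono insert.IH) auto
  also have "(\<integral>\<^sup>+z. h' z \<partial>PiM I \<rho>) = (\<integral>\<^sup>+z. h z \<partial>PiM (insert i I) \<rho>)"
    unfolding h'_def using insert.hyps by (intro product_nn_integral_insert[symmetric]) measurable
  finally show ?case
    using insert.hyps by (simp add: exp_add ennreal_mult' mult.assoc)
qed

text \<open>Row \<open>j\<close> of \<open>G\<close> holds the weights of the \<open>T\<close>
  independent sources in the noise of node \<open>j\<close>. The restriction to
  \<open>{..<N}\<close> makes the vector extensional, as the points of \<open>noise_space N\<close>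
  are.\<close>

definition linear_noise :: "nat \<Rightarrow> nat \<Rightarrow> (nat \<Rightarrow> nat \<Rightarrow> real) \<Rightarrow> (nat \<Rightarrow> real measure) \<Rightarrow> (nat \<Rightarrow> real) measure" where
  "linear_noise N T G \<rho> =
     distr (PiM {..<T} \<rho>) (noise_space N) (\<lambda>z. \<lambda>j\<in>{..<N}. \<Sum>m<T. G j m * z m)"

lemma measurable_linear_noise:
  assumes "\<And>m. sets (\<rho> m) = sets borel"
  shows "(\<lambda>z. \<lambda>j\<in>{..<N}. \<Sum>m<T. G j m * z m) \<in> PiM {..<T} \<rho> \<rightarrow>\<^sub>M noise_space N"
proof -
  note assms[measurable_cong]
  show ?thesis unfolding noise_space_def by measurable
qed

text \<open>If the observations of the coalition \<open>S\<close> react to the secret as to a shift of the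
  noise along \<open>v\<close>, then changing the secret is absorbed by the noise.\<close>

lemma linear_noise_private:
  fixes \<rho> :: "nat \<Rightarrow> real measure" and \<epsilon> :: "nat \<Rightarrow> real"
  assumes prob: "\<And>m. prob_space (\<rho> m)" and sets_\<rho>: "\<And>m. sets (\<rho> m) = sets borel"
    and priv: "\<And>m. shift_private (\<epsilon> m) (\<rho> m)"
    and S: "S \<subseteq> {..<N}" and v: "\<And>m. \<bar>v m\<bar> \<le> 1" "\<And>j. j \<in> S \<Longrightarrow> (\<Sum>m<T. G j m * v m) = 1"
    and a: "\<bar>a0 - a1\<bar> \<le> 1" and B: "B \<in> sets (PiM S (\<lambda>_. borel))"
  shows "measure (linear_noise N T G \<rho>) {x \<in> space (linear_noise N T G \<rho>). (\<lambda>j\<in>S. a0 + x j) \<in> B}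
     \<le> exp (\<Sum>m<T. \<epsilon> m) *
        measure (linear_noise N T G \<rho>) {x \<in> space (linear_noise N T G \<rho>). (\<lambda>j\<in>S. a1 + x j) \<in> B}"
proof -
  note sets_\<rho>[measurable_cong] B[measurable]
  have sets_PiM: "sets (PiM J \<rho>) = sets (PiM J (\<lambda>_. borel))" for J
    using sets_\<rho> by (intro sets_PiM_cong) auto
  interpret P: prob_space "PiM {..<T} \<rho>" using prob by (intro prob_space_PiM)
  interpret L: prob_space "linear_noise N T G \<rho>"
    unfolding linear_noise_def by (intro P.prob_space_distr measurable_linear_noise sets_\<rho>)
  have Sm: "(\<lambda>x. \<lambda>j\<in>S. c + x j) \<in> noise_space N \<rightarrow>\<^sub>M PiM S (\<lambda>_. borel :: real measure)" for c
    unfolding noise_space_def using S by (intro measurable_restrict) (auto intro!: borel_measurable_add measurable_component_singleton)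
  \<comment> \<open>The view of the coalition for the secret \<open>c\<close>, as a function of the
    sources.\<close>
  define obs where "obs c z = (\<lambda>j\<in>S. c + (\<Sum>m<T. G j m * z m))" for c :: real and z :: "nat \<Rightarrow> real"
  have obs_meas [measurable]: "obs c \<in> PiM {..<T} (\<lambda>_. borel) \<rightarrow>\<^sub>M PiM S (\<lambda>_. borel)" for c
    unfolding obs_def by measurable
  have em: "emeasure (linear_noise N T G \<rho>) {x \<in> space (linear_noise N T G \<rho>). (\<lambda>j\<in>S. c + x j) \<in> B}
      = (\<integral>\<^sup>+z. indicator B (obs c z) \<partial>PiM {..<T} \<rho>)" for c
  proof -
    let ?f = "\<lambda>z. \<lambda>j\<in>{..<N}. \<Sum>m<T. G j m * z m"
    have "{x \<in> space (linear_noise N T G \<rho>). (\<lambda>j\<in>S. c + x j) \<in> B} \<in> sets (noise_space N)"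
      using measurable_sets[OF Sm B, of c] by (simp add: linear_noise_def vimage_def Int_def conj_commute)
    hence "emeasure (linear_noise N T G \<rho>) {x \<in> space (linear_noise N T G \<rho>). (\<lambda>j\<in>S. c + x j) \<in> B}
       = (\<integral>\<^sup>+x. indicator {x \<in> space (linear_noise N T G \<rho>). (\<lambda>j\<in>S. c + x j) \<in> B} x \<partial>linear_noise N T G \<rho>)"
      by (intro nn_integral_indicator[symmetric]) (simp add: linear_noise_def)
    also have "\<dots> = (\<integral>\<^sup>+x. indicator B (\<lambda>j\<in>S. c + x j) \<partial>linear_noise N T G \<rho>)"
      by (intro nn_integral_cong) (auto simp: indicator_def)
    also have "\<dots> = (\<integral>\<^sup>+z. indicator B (\<lambda>j\<in>S. c + ?f z j) \<partial>PiM {..<T} \<rho>)"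
      unfolding linear_noise_def
      by (intro nn_integral_distr measurable_linear_noise sets_\<rho>)
        (simp, rule measurable_compose[OF Sm borel_measurable_indicator[OF B]])
    also have "\<dots> = (\<integral>\<^sup>+z. indicator B (obs c z) \<partial>PiM {..<T} \<rho>)"
      using S unfolding obs_def
      by (intro nn_integral_cong arg_cong[where f = "indicator B"]) (auto simp: fun_eq_iff restrict_def)
    finally show ?thesis .
  qed
  \<comment> \<open>Every row of the coalition pairs with \<open>v\<close> to 1, so replacing the
    secret \<open>a1\<close> by \<open>a0\<close> amounts to shifting the sources by
    \<open>(a0 - a1) * v m\<close>.\<close>
  define t where "t m = (a0 - a1) * v m" for m
  have t: "\<bar>t m\<bar> \<le> 1" for m
    using mult_mono[OF a v(1)[of m]] by (simp add: t_def abs_mult)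
  have shift: "obs a0 z = obs a1 (\<lambda>m\<in>{..<T}. z m + t m)" for z
  proof -
    have "a1 + (\<Sum>m<T. G j m * (z m + t m)) = a0 + (\<Sum>m<T. G j m * z m)" if "j \<in> S" for j
    proof -
      have "(\<Sum>m<T. G j m * (z m + t m)) = (\<Sum>m<T. G j m * z m) + (a0 - a1) * (\<Sum>m<T. G j m * v m)"
        by (simp add: t_def distrib_left sum.distrib sum_distrib_left mult_ac)
      thus ?thesis using v(2)[OF that] by simp
    qed
    thus ?thesis by (auto simp: obs_def fun_eq_iff restrict_def)
  qed
  have "(\<integral>\<^sup>+z. indicator B (obs a0 z) \<partial>PiM {..<T} \<rho>) \<le>
      ennreal (exp (\<Sum>m<T. \<epsilon> m)) * (\<integral>\<^sup>+z. indicator B (obs a1 z) \<partial>PiM {..<T} \<rho>)"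
    unfolding shift
    by (rule shift_private_PiM[OF prob sets_\<rho> priv _ t, where h = "\<lambda>z. indicator B (obs a1 z)"]) auto
  thus ?thesis
    unfolding em[symmetric] L.emeasure_eq_measure
    by (simp add: ennreal_mult'[symmetric] ennreal_le_iff)
qed

section \<open>The mean square error\<close>

lemma PiM_component_moments:
  fixes \<rho> :: "nat \<Rightarrow> real measure" and \<tau> :: "nat \<Rightarrow> real"
  assumes \<rho>: "\<And>m. valid_input (\<tau> m) (\<rho> m)" and \<tau>: "\<And>m. (\<integral>x. x ^ 2 \<partial>\<rho> m) = \<tau> m"
    and mn: "m < T" "n < T"
  shows "integrable (PiM {..<T} \<rho>) (\<lambda>z. z m)" "(\<integral>z. z m \<partial>PiM {..<T} \<rho>) = 0"
    "integrable (PiM {..<T} \<rho>) (\<lambda>z. z m * z n)"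
    "(\<integral>z. z m * z n \<partial>PiM {..<T} \<rho>) = (if m = n then \<tau> m else 0)"
proof -
  have prob: "prob_space (\<rho> k)" for k using \<rho>[of k] by (simp add: valid_input_def)
  interpret product_sigma_finite \<rho>
    using prob by (intro product_sigma_finite.intro prob_space_imp_sigma_finite)
  have int: "integrable (\<rho> k) (\<lambda>x. x)" "integrable (\<rho> k) (\<lambda>x. x * x)"
    "(\<integral>x. x \<partial>\<rho> k) = 0" "(\<integral>x. x * x \<partial>\<rho> k) = \<tau> k" for k
    using \<rho>[of k] \<tau>[of k] unfolding valid_input_def power2_eq_square by blast+
  have one: "integrable (\<rho> k) (\<lambda>x. 1 :: real)" "(\<integral>x. (1::real) \<partial>\<rho> k) = 1" for k
  proof -
    interpret prob_space "\<rho> k" by (rule prob)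
    show "integrable (\<rho> k) (\<lambda>x. 1 :: real)" "(\<integral>x. (1::real) \<partial>\<rho> k) = 1"
      by (simp_all add: prob_space)
  qed
  \<comment> \<open>\<open>z m\<close> and \<open>z m * z n\<close> are written as products over all
    coordinates, with the factor 1 away from \<open>m\<close> and \<open>n\<close>, so that the
    integrals factorise. If \<open>m = n\<close>, one coordinate of \<open>g\<close> carries the
    square.\<close>
  define f :: "nat \<Rightarrow> real \<Rightarrow> real" where "f = (\<lambda>k x. if k = m then x else 1)"
  define g :: "nat \<Rightarrow> real \<Rightarrow> real" where "g = (\<lambda>k x. (if k = m then x else 1) * (if k = n then x else 1))"
  have f_int: "integrable (\<rho> k) (f k)" for k
    using int(1) one(1) by (cases "k = m") (simp_all add: f_def)
  have g_int: "integrable (\<rho> k) (g k)" for k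
    using int(1,2) one(1) by (cases "k = m"; cases "k = n") (simp_all add: g_def)
  have f_prod: "(\<Prod>k<T. f k (z k)) = z m" for z
    using mn by (simp add: f_def)
  have g_prod: "(\<Prod>k<T. g k (z k)) = z m * z n" for z
    using mn by (simp add: g_def prod.distrib)
  show "integrable (PiM {..<T} \<rho>) (\<lambda>z. z m)"
    using product_integrable_prod[of "{..<T}" f] f_int by (simp add: f_prod)
  show "integrable (PiM {..<T} \<rho>) (\<lambda>z. z m * z n)"
    using product_integrable_prod[of "{..<T}" g] g_int by (simp add: g_prod)
  have "(\<integral>z. z m \<partial>PiM {..<T} \<rho>) = (\<Prod>k<T. integral\<^sup>L (\<rho> k) (f k))"
    using product_integral_prod[of "{..<T}" f] f_int by (simp add: f_prod)
  also have "\<dots> = 0" using mn int(3)[of m] by (intro prod_zero bexI[of _ m]) (simp_all add: f_def)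
  finally show "(\<integral>z. z m \<partial>PiM {..<T} \<rho>) = 0" .
  have "(\<integral>z. z m * z n \<partial>PiM {..<T} \<rho>) = (\<Prod>k<T. integral\<^sup>L (\<rho> k) (g k))"
    using product_integral_prod[of "{..<T}" g] g_int by (simp add: g_prod)
  also have "\<dots> = (if m = n then \<tau> m else 0)"
  proof (cases "m = n")
    case True
    have "integral\<^sup>L (\<rho> k) (g k) = (if k = m then \<tau> m else 1)" for k
      using int(4)[of k] one(2)[of k] True by (cases "k = m") (simp_all add: g_def)
    thus ?thesis using mn True by simp
  next
    case False
    thus ?thesis using mn int(3)[of m] by (simp add: g_def, intro prod_zero bexI[of _ m], simp_all)
  qed
  finally show "(\<integral>z. z m * z n \<partial>PiM {..<T} \<rho>) = (if m = n then \<tau> m else 0)" .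
qed

text \<open>Only the diagonal terms of the double sum survive for uncorrelated sources: the
  covariance matrix is \<open>G\<close> times the diagonal matrix of the \<open>\<tau> m\<close>
  times the transpose of \<open>G\<close>.\<close>

lemma linear_noise_moments:
  fixes N T :: nat and \<rho> :: "nat \<Rightarrow> real measure" and \<tau> :: "nat \<Rightarrow> real" and G :: "nat \<Rightarrow> nat \<Rightarrow> real"
  assumes \<rho>: "\<And>m. valid_input (\<tau> m) (\<rho> m)" and \<tau>: "\<And>m. (\<integral>x. x ^ 2 \<partial>\<rho> m) = \<tau> m"
  defines "\<mu> \<equiv> linear_noise N T G \<rho>"
  shows "prob_space \<mu>" "sets \<mu> = sets (noise_space N)"
    "j < N \<Longrightarrow> integrable \<mu> (\<lambda>x. x j)" "j < N \<Longrightarrow> (\<integral>x. x j \<partial>\<mu>) = 0"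
    "j < N \<Longrightarrow> l < N \<Longrightarrow> integrable \<mu> (\<lambda>x. x j * x l)"
    "j < N \<Longrightarrow> l < N \<Longrightarrow> (\<integral>x. x j * x l \<partial>\<mu>) = (\<Sum>m<T. G j m * G l m * \<tau> m)"
proof -
  have prob: "prob_space (\<rho> k)" and sets_\<rho>: "sets (\<rho> k) = sets borel" for k
    using \<rho>[of k] by (auto simp: valid_input_def)
  interpret P: prob_space "PiM {..<T} \<rho>" using prob by (intro prob_space_PiM)
  let ?f = "\<lambda>z. \<lambda>j\<in>{..<N}. \<Sum>m<T. G j m * z m"
  note meas = measurable_linear_noise[where N = N and T = T and G = G, OF sets_\<rho>]
  note mom = PiM_component_moments[OF \<rho> \<tau>, where T = T]
  show "prob_space \<mu>" unfolding \<mu>_def linear_noise_def by (rule P.prob_space_distr[OF meas])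
  show "sets \<mu> = sets (noise_space N)" by (simp add: \<mu>_def linear_noise_def)
  have comp [measurable]: "(\<lambda>x. x j) \<in> borel_measurable (noise_space N)" if "j < N" for j
    using that unfolding noise_space_def by (intro measurable_component_singleton) auto
  show "integrable \<mu> (\<lambda>x. x j)" "(\<integral>x. x j \<partial>\<mu>) = 0" if j: "j < N"
  proof -
    have int: "integrable (PiM {..<T} \<rho>) (\<lambda>z. \<Sum>m<T. G j m * z m)"
      by (intro Bochner_Integration.integrable_sum integrable_mult_right mom(1)) auto
    thus "integrable \<mu> (\<lambda>x. x j)"
      unfolding \<mu>_def linear_noise_def using j by (subst integrable_distr_eq[OF meas comp]) auto
    have "(\<integral>x. x j \<partial>\<mu>) = (\<integral>z. ?f z j \<partial>PiM {..<T} \<rho>)"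
      unfolding \<mu>_def linear_noise_def by (rule integral_distr[OF meas comp[OF j]])
    also have "\<dots> = (\<integral>z. (\<Sum>m<T. G j m * z m) \<partial>PiM {..<T} \<rho>)" using j by simp
    also have "\<dots> = (\<Sum>m<T. G j m * (\<integral>z. z m \<partial>PiM {..<T} \<rho>))"
      by (subst Bochner_Integration.integral_sum) (auto intro!: integrable_mult_right mom(1))
    also have "\<dots> = 0" by (simp add: mom(2))
    finally show "(\<integral>x. x j \<partial>\<mu>) = 0" .
  qed
  show "integrable \<mu> (\<lambda>x. x j * x l)" "(\<integral>x. x j * x l \<partial>\<mu>) = (\<Sum>m<T. G j m * G l m * \<tau> m)"
    if jl: "j < N" "l < N"
  proof -
    have eq: "?f z j * ?f z l = (\<Sum>m<T. \<Sum>n<T. G j m * G l n * (z m * z n))" for z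
      using jl by (simp add: sum_product mult_ac)
    have comp2: "(\<lambda>x. x j * x l) \<in> borel_measurable (noise_space N)"
      using jl by measurable
    have int: "integrable (PiM {..<T} \<rho>) (\<lambda>z. \<Sum>m<T. \<Sum>n<T. G j m * G l n * (z m * z n))"
      by (intro Bochner_Integration.integrable_sum integrable_mult_right mom(3)) auto
    thus "integrable \<mu> (\<lambda>x. x j * x l)"
      unfolding \<mu>_def linear_noise_def by (subst integrable_distr_eq[OF meas comp2]) (simp only: eq)
    have "(\<integral>x. x j * x l \<partial>\<mu>) = (\<integral>z. ?f z j * ?f z l \<partial>PiM {..<T} \<rho>)"
      unfolding \<mu>_def linear_noise_def by (rule integral_distr[OF meas comp2])
    also have "\<dots> = (\<Sum>m<T. \<integral>z. (\<Sum>n<T. G j m * G l n * (z m * z n)) \<partial>PiM {..<T} \<rho>)"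
      unfolding eq
      by (intro Bochner_Integration.integral_sum Bochner_Integration.integrable_sum integrable_mult_right mom(3)) auto
    also have "\<dots> = (\<Sum>m<T. \<Sum>n<T. G j m * G l n * (\<integral>z. z m * z n \<partial>PiM {..<T} \<rho>))"
      by (intro sum.cong refl, subst Bochner_Integration.integral_sum)
         (auto intro!: integrable_mult_right mom(3))
    also have "\<dots> = (\<Sum>m<T. \<Sum>n<T. G j m * G l n * (if m = n then \<tau> m else 0))"
      by (intro sum.cong refl arg_cong2[where f = "(*)"] mom(4)) auto
    also have "\<dots> = (\<Sum>m<T. G j m * G l m * \<tau> m)"
      by (simp add: if_distrib sum.delta cong: if_cong)
    finally show "(\<integral>x. x j * x l \<partial>\<mu>) = (\<Sum>m<T. G j m * G l m * \<tau> m)" .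
  qed
qed

text \<open>The cross terms vanish because the input is centred and independent of the noises.
  \<open>u\<close> and \<open>w\<close> are arbitrary functions so that 0 is allowed, for a node
  without noise.\<close>

lemma noisy_pair_second_moment:
  fixes \<nu> :: "real measure" and \<mu> :: "'a measure" and u w :: "'a \<Rightarrow> real"
  assumes \<nu>: "valid_input \<eta> \<nu>" and \<mu>: "prob_space \<mu>"
    and u: "integrable \<mu> u" "(\<integral>x. u x \<partial>\<mu>) = 0" and w: "integrable \<mu> w" "(\<integral>x. w x \<partial>\<mu>) = 0"
    and uw: "integrable \<mu> (\<lambda>x. u x * w x)"
  shows "integrable (\<nu> \<Otimes>\<^sub>M \<mu>) (\<lambda>p. (fst p + u (snd p)) * (fst p + w (snd p)))"
    "(\<integral>p. (fst p + u (snd p)) * (fst p + w (snd p)) \<partial>(\<nu> \<Otimes>\<^sub>M \<mu>)) =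
       (\<integral>a. a ^ 2 \<partial>\<nu>) + (\<integral>x. u x * w x \<partial>\<mu>)"
proof -
  interpret N: prob_space \<nu> using \<nu> by (simp add: valid_input_def)
  interpret M: prob_space \<mu> by fact
  interpret P: pair_prob_space \<nu> \<mu> ..
  have \<nu>_sets [measurable_cong]: "sets \<nu> = sets borel" using \<nu> by (simp add: valid_input_def)
  have a: "integrable \<nu> (\<lambda>a. a)" "integrable \<nu> (\<lambda>a. a ^ 2)" "(\<integral>a. a \<partial>\<nu>) = 0"
    using \<nu> by (auto simp: valid_input_def)
  note [measurable] = borel_measurable_integrable[OF u(1)] borel_measurable_integrable[OF w(1)]
  have prod: "integrable (\<nu> \<Otimes>\<^sub>M \<mu>) (\<lambda>p. f (fst p) * g (snd p))"
     "(\<integral>p. f (fst p) * g (snd p) \<partial>(\<nu> \<Otimes>\<^sub>M \<mu>)) = (\<integral>a. f a \<partial>\<nu>) * (\<integral>x. g x \<partial>\<mu>)"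
    if f: "integrable \<nu> f" and g: "integrable \<mu> g" for f :: "real \<Rightarrow> real" and g :: "'a \<Rightarrow> real"
  proof -
    note [measurable] = borel_measurable_integrable[OF f] borel_measurable_integrable[OF g]
    show *: "integrable (\<nu> \<Otimes>\<^sub>M \<mu>) (\<lambda>p. f (fst p) * g (snd p))"
      using f g by (intro P.Fubini_integrable) (auto simp: abs_mult)
    show "(\<integral>p. f (fst p) * g (snd p) \<partial>(\<nu> \<Otimes>\<^sub>M \<mu>)) = (\<integral>a. f a \<partial>\<nu>) * (\<integral>x. g x \<partial>\<mu>)"
      using P.integral_fst'[OF *] by simp
  qed
  have one: "integrable \<nu> (\<lambda>_. 1 :: real)" "integrable \<mu> (\<lambda>_. 1 :: real)" by auto
  have eq: "(fst p + u (snd p)) * (fst p + w (snd p)) =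
     (fst p) ^ 2 * 1 + fst p * u (snd p) + fst p * w (snd p) + 1 * (u (snd p) * w (snd p))" for p
    by (simp add: algebra_simps power2_eq_square)
  note ints = prod(1)[OF a(2) one(2)] prod(1)[OF a(1) u(1)] prod(1)[OF a(1) w(1)] prod(1)[OF one(1) uw]
  show "integrable (\<nu> \<Otimes>\<^sub>M \<mu>) (\<lambda>p. (fst p + u (snd p)) * (fst p + w (snd p)))"
    unfolding eq by (intro Bochner_Integration.integrable_add ints)
  have "(\<integral>p. (fst p + u (snd p)) * (fst p + w (snd p)) \<partial>(\<nu> \<Otimes>\<^sub>M \<mu>)) =
      (\<integral>p. (fst p) ^ 2 * 1 \<partial>(\<nu> \<Otimes>\<^sub>M \<mu>)) + (\<integral>p. fst p * u (snd p) \<partial>(\<nu> \<Otimes>\<^sub>M \<mu>))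
      + (\<integral>p. fst p * w (snd p) \<partial>(\<nu> \<Otimes>\<^sub>M \<mu>)) + (\<integral>p. 1 * (u (snd p) * w (snd p)) \<partial>(\<nu> \<Otimes>\<^sub>M \<mu>))"
    unfolding eq using ints by (simp only: Bochner_Integration.integral_add Bochner_Integration.integrable_add)
  also have "\<dots> = (\<integral>a. a ^ 2 \<partial>\<nu>) + (\<integral>x. u x * w x \<partial>\<mu>)"
    unfolding prod(2)[OF a(2) one(2)] prod(2)[OF a(1) u(1)] prod(2)[OF a(1) w(1)] prod(2)[OF one(1) uw]
    using a u w by (simp add: M.prob_space N.prob_space)
  finally show "(\<integral>p. (fst p + u (snd p)) * (fst p + w (snd p)) \<partial>(\<nu> \<Otimes>\<^sub>M \<mu>)) =
       (\<integral>a. a ^ 2 \<partial>\<nu>) + (\<integral>x. u x * w x \<partial>\<mu>)" .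
qed

text \<open>The target product is treated as the output of an additional node \<open>N\<close> with noise
  \<open>0\<close> and decoding coefficient \<open>-1\<close>.\<close>

lemma expected_sq_error:
  fixes \<nu> :: "nat \<Rightarrow> real measure" and \<mu> :: "nat \<Rightarrow> (nat \<Rightarrow> real) measure" and K :: "nat \<Rightarrow> nat \<Rightarrow> real"
  assumes \<nu>: "\<And>i. i < M \<Longrightarrow> valid_input \<eta> (\<nu> i)" and \<mu>: "valid_noise N M \<mu>"
    and K: "\<And>i j l. i < M \<Longrightarrow> j < N \<Longrightarrow> l < N \<Longrightarrow> integrable (\<mu> i) (\<lambda>x. x j * x l)"
      "\<And>i j l. i < M \<Longrightarrow> j < N \<Longrightarrow> l < N \<Longrightarrow> (\<integral>x. x j * x l \<partial>\<mu> i) = K j l"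
    and K0: "\<And>j. K j N = 0" "\<And>l. K N l = 0" and dN: "d N = -1"
  shows "(\<integral>\<^sup>+\<omega>. ennreal (sq_error N M d \<omega>) \<partial>PiM {..<M} (\<lambda>i. \<nu> i \<Otimes>\<^sub>M \<mu> i)) =
    ennreal (\<Sum>j\<le>N. \<Sum>l\<le>N. d j * d l * (\<Prod>i<M. (\<integral>a. a ^ 2 \<partial>\<nu> i) + K j l))"
proof -
  \<comment> \<open>Inputs and noises are controlled only for \<open>i < M\<close>, whereas
    \<open>product_sigma_finite\<close> speaks of every index; a point mass fills the rest.\<close>
  define Q where "Q i = (if i < M then \<nu> i \<Otimes>\<^sub>M \<mu> i else return (borel \<Otimes>\<^sub>M noise_space N) (0, \<lambda>_\<in>{..<N}. 0))" for i
  \<comment> \<open>The factor contributed by node \<open>j\<close>; for \<open>j = N\<close> it is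
    the bare input, the factor of the target.\<close>
  define e where "e j p = fst p + (if j < N then snd p j else 0)" for j and p :: "real \<times> (nat \<Rightarrow> real)"
  have mu: "prob_space (\<mu> i)" "\<And>j. j < N \<Longrightarrow> integrable (\<mu> i) (\<lambda>x. x j)" "\<And>j. j < N \<Longrightarrow> (\<integral>x. x j \<partial>\<mu> i) = 0"
    if "i < M" for i using \<mu> that by (auto simp: valid_noise_def)
  have prob_Q: "prob_space (Q i)" for i
  proof (cases "i < M")
    case True
    interpret N: prob_space "\<nu> i" using \<nu>[OF True] by (simp add: valid_input_def)
    interpret M: prob_space "\<mu> i" by (rule mu[OF True])
    interpret P: pair_prob_space "\<nu> i" "\<mu> i" ..
    show ?thesis using True P.prob_space_axioms by (simp add: Q_def)
  next
    case False
    have "(0, \<lambda>_\<in>{..<N}. 0) \<in> space (borel \<Otimes>\<^sub>M noise_space N :: (real \<times> (nat \<Rightarrow> real)) measure)"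
      by (simp add: space_pair_measure noise_space_def space_PiM)
    thus ?thesis using False by (simp add: Q_def prob_space_return)
  qed
  interpret product_sigma_finite Q
    using prob_Q by (intro product_sigma_finite.intro prob_space_imp_sigma_finite)
  have PiM_eq: "PiM {..<M} (\<lambda>i. \<nu> i \<Otimes>\<^sub>M \<mu> i) = PiM {..<M} Q"
    by (intro PiM_cong) (auto simp: Q_def)
  have e_mom: "integrable (Q i) (\<lambda>p. e j p * e l p) \<and>
      (\<integral>p. e j p * e l p \<partial>Q i) = (\<integral>a. a ^ 2 \<partial>\<nu> i) + K j l"
    if i: "i < M" and jl: "j \<le> N" "l \<le> N" for i j l
  proof -
    define u where "u j x = (if j < N then x j else 0)" for j and x :: "nat \<Rightarrow> real"
    have u: "integrable (\<mu> i) (u j)" "(\<integral>x. u j x \<partial>\<mu> i) = 0" for j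
      using mu[OF i] by (cases "j < N"; simp add: u_def[abs_def])+
    have uu: "integrable (\<mu> i) (\<lambda>x. u j x * u l x)" "(\<integral>x. u j x * u l x \<partial>\<mu> i) = K j l"
      using K[OF i, of j l] K0 jl by (cases "j < N"; cases "l < N"; simp add: u_def)+
    show ?thesis
      using noisy_pair_second_moment[OF \<nu>[OF i] mu(1)[OF i] u[of j] u[of l] uu(1)] i
      by (simp add: Q_def e_def u_def[symmetric] uu(2))
  qed
  have sq: "sq_error N M d \<omega> = (\<Sum>j\<le>N. \<Sum>l\<le>N. d j * d l * (\<Prod>i<M. e j (\<omega> i) * e l (\<omega> i)))" for \<omega>
  proof -
    have "(\<Sum>j<N. d j * (\<Prod>i<M. fst (\<omega> i) + snd (\<omega> i) j)) - (\<Prod>i<M. fst (\<omega> i)) =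
        (\<Sum>j\<le>N. d j * (\<Prod>i<M. e j (\<omega> i)))"
      by (simp add: lessThan_Suc_atMost[symmetric] e_def dN)
    thus ?thesis
      unfolding sq_error_def by (simp add: power2_eq_square sum_product prod.distrib mult_ac)
  qed
  \<comment> \<open>The pairs of input and noise are independent over \<open>i\<close>, so the
    expectation of each product factorises.\<close>
  have int_prod: "integrable (PiM {..<M} Q) (\<lambda>\<omega>. \<Prod>i<M. e j (\<omega> i) * e l (\<omega> i))"
    "(\<integral>\<omega>. (\<Prod>i<M. e j (\<omega> i) * e l (\<omega> i)) \<partial>PiM {..<M} Q) = (\<Prod>i<M. (\<integral>a. a ^ 2 \<partial>\<nu> i) + K j l)"
    if "j \<le> N" "l \<le> N" for j l
    using product_integrable_prod[of "{..<M}" "\<lambda>_ p. e j p * e l p"]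
      product_integral_prod[of "{..<M}" "\<lambda>_ p. e j p * e l p"] e_mom[OF _ that] by auto
  have int: "integrable (PiM {..<M} Q) (sq_error N M d)"
    unfolding sq[abs_def] by (intro Bochner_Integration.integrable_sum integrable_mult_right int_prod) auto
  have "(\<integral>\<^sup>+\<omega>. ennreal (sq_error N M d \<omega>) \<partial>PiM {..<M} Q) = ennreal (\<integral>\<omega>. sq_error N M d \<omega> \<partial>PiM {..<M} Q)"
    by (intro nn_integral_eq_integral int) (simp add: sq_error_def)
  also have "(\<integral>\<omega>. sq_error N M d \<omega> \<partial>PiM {..<M} Q) =
      (\<Sum>j\<le>N. \<Sum>l\<le>N. d j * d l * (\<Prod>i<M. (\<integral>a. a ^ 2 \<partial>\<nu> i) + K j l))"
    unfolding sq
    by (subst Bochner_Integration.integral_sum, (intro Bochner_Integration.integrable_sum integrable_mult_right int_prod; simp),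
        intro sum.cong refl, subst Bochner_Integration.integral_sum,
        (intro integrable_mult_right int_prod; simp), simp add: int_prod)
  finally show ?thesis unfolding PiM_eq .
qed

section \<open>Monotonicity of the error in the input variances\<close>

text \<open>The Schur product theorem for Gram matrices: expanding the factor of one index
  \<open>i\<close> and absorbing \<open>u i m j\<close> into \<open>d j\<close> leaves a sum over
  \<open>m\<close> of forms with one factor fewer. Hence \<open>d\<close> varies in the
  induction.\<close>

lemma Gram_product_form_nonneg:
  fixes d :: "'a \<Rightarrow> real" and u :: "'i \<Rightarrow> 'b \<Rightarrow> 'a \<Rightarrow> real"
  assumes "finite I"
  shows "0 \<le> (\<Sum>j\<in>J. \<Sum>l\<in>J. d j * d l * (\<Prod>i\<in>I. \<Sum>m\<in>B. u i m j * u i m l))"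
  using assms
proof (induction I arbitrary: d)
  case empty
  have "(\<Sum>j\<in>J. \<Sum>l\<in>J. d j * d l) = (\<Sum>j\<in>J. d j) ^ 2"
    by (simp add: power2_eq_square sum_product)
  thus ?case by simp
next
  case (insert i I)
  let ?P = "\<lambda>j l. \<Prod>i\<in>I. \<Sum>m\<in>B. u i m j * u i m l"
  have "(\<Sum>j\<in>J. \<Sum>l\<in>J. d j * d l * (\<Prod>i\<in>insert i I. \<Sum>m\<in>B. u i m j * u i m l)) =
      (\<Sum>j\<in>J. \<Sum>l\<in>J. \<Sum>m\<in>B. (d j * u i m j) * (d l * u i m l) * ?P j l)"
    using insert.hyps by (simp add: sum_distrib_left sum_distrib_right mult_ac)
  also have "\<dots> = (\<Sum>m\<in>B. \<Sum>j\<in>J. \<Sum>l\<in>J. (d j * u i m j) * (d l * u i m l) * ?P j l)"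
    by (subst sum.swap[where B = B and A = J], subst (2) sum.swap) (rule refl)
  also have "\<dots> \<ge> 0" by (intro sum_nonneg insert.IH)
  finally show ?case .
qed

text \<open>The derivative of the form in each \<open>v i\<close> is again a form of the same kind,
  hence nonnegative.\<close>

lemma Gram_product_form_mono:
  fixes d :: "'a \<Rightarrow> real" and g :: "'b \<Rightarrow> 'a \<Rightarrow> real" and v :: "'i \<Rightarrow> real"
  assumes "finite I" "\<And>m. m \<in> B \<Longrightarrow> 0 \<le> \<tau> m" "\<And>i. i \<in> I \<Longrightarrow> 0 \<le> v i" "\<And>i. i \<in> I \<Longrightarrow> v i \<le> \<eta>"
    "finite B"
  shows "(\<Sum>j\<in>J. \<Sum>l\<in>J. d j * d l * (\<Prod>i\<in>I. v i + (\<Sum>m\<in>B. g m j * g m l * \<tau> m)))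
    \<le> (\<Sum>j\<in>J. \<Sum>l\<in>J. d j * d l * (\<eta> + (\<Sum>m\<in>B. g m j * g m l * \<tau> m)) ^ card I)"
proof -
  define K where "K j l = (\<Sum>m\<in>B. g m j * g m l * \<tau> m)" for j l
  define F where "F w = (\<Sum>j\<in>J. \<Sum>l\<in>J. d j * d l * (\<Prod>i\<in>I. w i + K j l))" for w :: "'i \<Rightarrow> real"
  have step: "F w \<le> F (w(k := \<eta>))" if k: "k \<in> I" and w: "\<And>i. i \<in> I \<Longrightarrow> 0 \<le> w i" "w k \<le> \<eta>" for k w
  proof -
    \<comment> \<open>The extra index \<open>None\<close> carries the constant
      \<open>sqrt (w i)\<close>, which brings \<open>w i + K j l\<close> into Gram form.\<close>
    define u where "u i m j = (case m of None \<Rightarrow> sqrt (w i) | Some m \<Rightarrow> g m j * sqrt (\<tau> m))" for i m j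
    let ?I = "I - {k}" and ?B = "insert None (Some ` B)"
    have Gram: "w i + K j l = (\<Sum>m\<in>?B. u i m j * u i m l)" if "i \<in> I" for i j l
    proof -
      have "(\<Sum>m\<in>?B. u i m j * u i m l) = w i + (\<Sum>m\<in>B. (g m j * sqrt (\<tau> m)) * (g m l * sqrt (\<tau> m)))"
        using w(1)[OF that] \<open>finite B\<close> by (subst sum.insert) (auto simp: u_def sum.reindex)
      also have "(\<Sum>m\<in>B. (g m j * sqrt (\<tau> m)) * (g m l * sqrt (\<tau> m))) = K j l"
        unfolding K_def
      proof (intro sum.cong refl)
        fix m assume "m \<in> B"
        have "(g m j * sqrt (\<tau> m)) * (g m l * sqrt (\<tau> m)) = g m j * g m l * (sqrt (\<tau> m) * sqrt (\<tau> m))"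
          by (simp add: mult_ac)
        thus "(g m j * sqrt (\<tau> m)) * (g m l * sqrt (\<tau> m)) = g m j * g m l * \<tau> m"
          using assms(2)[OF \<open>m \<in> B\<close>] by simp
      qed
      finally show ?thesis by simp
    qed
    have expand: "(\<Prod>i\<in>I. (w(k := c)) i + K j l) = (c + K j l) * (\<Prod>i\<in>?I. w i + K j l)" for c j l
      using k \<open>finite I\<close> by (subst prod.remove[of I k]) auto
    have "F (w(k := \<eta>)) - F (w(k := w k)) =
        (\<eta> - w k) * (\<Sum>j\<in>J. \<Sum>l\<in>J. d j * d l * (\<Prod>i\<in>?I. w i + K j l))"
      unfolding F_def expand
      by (simp add: sum_subtractf[symmetric] sum_distrib_left algebra_simps)
    also have "(\<Sum>j\<in>J. \<Sum>l\<in>J. d j * d l * (\<Prod>i\<in>?I. w i + K j l)) =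
        (\<Sum>j\<in>J. \<Sum>l\<in>J. d j * d l * (\<Prod>i\<in>?I. \<Sum>m\<in>?B. u i m j * u i m l))"
      by (intro sum.cong refl arg_cong2[where f = "(*)"] prod.cong Gram) auto
    also have "(\<eta> - w k) * \<dots> \<ge> 0"
      using w(2) \<open>finite I\<close> by (intro mult_nonneg_nonneg Gram_product_form_nonneg) auto
    finally show ?thesis by (simp add: fun_upd_def)
  qed
  \<comment> \<open>The variances are raised to \<eta> one at a time; \<open>A\<close> is the set
    already raised.\<close>
  have main: "F v \<le> F (\<lambda>i. if i \<in> A then \<eta> else v i)" if "A \<subseteq> I" for A
    using finite_subset[OF that \<open>finite I\<close>] that
  proof (induction A)
    case (insert k A)
    let ?w = "\<lambda>i. if i \<in> A then \<eta> else v i"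
    have "F v \<le> F ?w" using insert by simp
    also have "\<dots> \<le> F (?w(k := \<eta>))"
    proof (rule step)
      show "0 \<le> ?w i" if "i \<in> I" for i using assms(3,4)[OF that] by auto
    qed (use insert.prems assms(4) in auto)
    also have "?w(k := \<eta>) = (\<lambda>i. if i \<in> insert k A then \<eta> else v i)" by auto
    finally show ?case .
  qed simp
  from main[of I] show ?thesis
    by (simp add: F_def K_def cong: prod.cong)
qed

text \<open>An exact expansion with continuous factor \<psi> in the remainder: for \<open>h\<close>
  of order \<delta>, the remainder divided by \<open>\<delta> ^ 2\<close> tends to 0. Writing the
  exponent as \<open>n + 2\<close> avoids subtraction.\<close>

lemma power_add_Taylor2:
  fixes q :: real
  shows "\<exists>\<psi>. continuous_on UNIV \<psi> \<and> (\<forall>h. (q + h) ^ Suc (Suc n) =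
     q ^ Suc (Suc n) + real (n + 2) * q ^ Suc n * h + real ((n + 1) * (n + 2)) / 2 * q ^ n * h ^ 2 + h ^ 3 * \<psi> h)"
proof (induction n)
  case 0
  show ?case
    by (intro exI[of _ "\<lambda>_. 0"]) (auto simp: power2_eq_square algebra_simps)
next
  case (Suc n)
  then obtain \<psi> where \<psi>: "continuous_on UNIV \<psi>" "\<And>h. (q + h) ^ Suc (Suc n) =
     q ^ Suc (Suc n) + real (n + 2) * q ^ Suc n * h + real ((n + 1) * (n + 2)) / 2 * q ^ n * h ^ 2 + h ^ 3 * \<psi> h"
    by blast
  \<comment> \<open>The old remainder times \<open>q + h\<close>, together with \<open>h\<close>
    times the quadratic term.\<close>
  define \<psi>' where "\<psi>' h = (q + h) * \<psi> h + real ((n + 1) * (n + 2)) / 2 * q ^ n" for h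
  have "(q + h) ^ Suc (Suc (Suc n)) = q ^ Suc (Suc (Suc n)) + real (Suc n + 2) * q ^ Suc (Suc n) * h
      + real ((Suc n + 1) * (Suc n + 2)) / 2 * q ^ Suc n * h ^ 2 + h ^ 3 * \<psi>' h" for h
    unfolding power_Suc[of "q + h" "Suc (Suc n)"] \<psi>(2) \<psi>'_def
    by (simp add: field_simps power2_eq_square power3_eq_cube)
  moreover have "continuous_on UNIV \<psi>'" unfolding \<psi>'_def using \<psi>(1) by (intro continuous_intros)
  ultimately show ?case by blast
qed

section \<open>The coding scheme\<close>

text \<open>Relative to row 0, the rows 1 to \<open>T\<close> change by \<delta> times vectors whose
  sum is the unit vector of \<open>z 0\<close>; this makes the auxiliary noises cancel. Rows above
  \<open>T\<close> are 0, so index \<open>T + 1\<close> can stand for the target.\<close>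

definition node_coeff :: "nat \<Rightarrow> real \<Rightarrow> nat \<Rightarrow> nat \<Rightarrow> real" where
  "node_coeff T \<delta> j m =
     (if j < T then (if m = 0 then 1 else if m = j then \<delta> else 0)
      else if j = T then (if m = 0 then 1 + \<delta> else - \<delta>) else 0)"

text \<open>On the nodes this is \<open>a\<close> times the output of node 0 plus \<open>b\<close>
  times the sum of the difference quotients of nodes 1 to \<open>T\<close> against node 0, a
  numerical derivative in the direction of \<open>z 0\<close>. The entry -1 belongs to the
  target.\<close>

definition decoder :: "nat \<Rightarrow> real \<Rightarrow> real \<Rightarrow> real \<Rightarrow> nat \<Rightarrow> real" where
  "decoder T \<delta> a b j = (if j = 0 then a - real T * (b / \<delta>) else if j \<le> T then b / \<delta> else - 1)"

lemma sum_lessThan_split_0: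
  assumes "0 < (T::nat)"
  shows "(\<Sum>m<T. f m) = f 0 + (\<Sum>m\<in>{1..<T}. f m :: real)"
  using assms by (simp add: lessThan_atLeast0 sum.atLeast_Suc_lessThan)

text \<open>A coalition of \<open>T\<close> nodes misses exactly one node \<open>k\<close>, and
  \<open>v\<close> is explicit for each \<open>k\<close>.\<close>

lemma node_coeff_shift_direction:
  assumes T: "0 < T" and \<delta>: "0 < \<delta>" and S: "S \<subseteq> {..<T + 1}" "card S = T"
  obtains v where "\<And>m. \<bar>v m\<bar> \<le> 1" "\<And>j. j \<in> S \<Longrightarrow> (\<Sum>m<T. node_coeff T \<delta> j m * v m) = 1"
proof -
  have "card ({..<T + 1} - S) = 1" using S by (subst card_Diff_subset) (auto intro: finite_subset)
  then obtain k where k: "{..<T + 1} - S = {k}" by (auto simp: card_1_singleton_iff)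
  have notin: "j \<noteq> k" "j \<le> T" if "j \<in> S" for j
    using k S(1) that by (blast, fastforce)
  have "k \<in> {..<T + 1}" using k by blast
  hence k': "k \<le> T" by simp
  consider "k = T" | "0 < k" "k < T" | "k = 0" using k' by linarith
  thus ?thesis
  proof cases
    case 1
    \<comment> \<open>All rows below \<open>T\<close> have weight 1 on \<open>z 0\<close>, so
      shifting \<open>z 0\<close> alone works.\<close>
    show ?thesis
    proof (rule that[of "\<lambda>m. if m = 0 then 1 else 0"])
      fix j assume "j \<in> S"
      thus "(\<Sum>m<T. node_coeff T \<delta> j m * (if m = 0 then 1 else 0)) = 1"
        using notin[of j] 1 T by (simp add: sum_lessThan_split_0 node_coeff_def)
    qed auto
  next
    case 2
    \<comment> \<open>Among the remaining rows only row \<open>T\<close> involves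
      \<open>z k\<close>, and there \<open>(1 + \<delta>) - \<delta> = 1\<close>.\<close>
    show ?thesis
    proof (rule that[of "\<lambda>m. if m = 0 \<or> m = k then 1 else 0"])
      fix j assume j: "j \<in> S"
      have "(\<Sum>m<T. node_coeff T \<delta> j m * (if m = 0 \<or> m = k then 1 else 0)) =
          node_coeff T \<delta> j 0 + (\<Sum>m\<in>{1..<T}. if m = k then node_coeff T \<delta> j k else 0)"
      proof -
        have "(\<Sum>m\<in>{1..<T}. node_coeff T \<delta> j m * (if m = 0 \<or> m = k then 1 else 0)) =
            (\<Sum>m\<in>{1..<T}. if m = k then node_coeff T \<delta> j k else 0)"
          by (intro sum.cong) auto
        thus ?thesis unfolding sum_lessThan_split_0[OF T] by simp
      qed
      also have "\<dots> = node_coeff T \<delta> j 0 + node_coeff T \<delta> j k" using 2 by simp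
      also have "\<dots> = 1" using notin[OF j] 2 by (auto simp: node_coeff_def)
      finally show "(\<Sum>m<T. node_coeff T \<delta> j m * (if m = 0 \<or> m = k then 1 else 0)) = 1" .
    qed auto
  next
    case 3
    \<comment> \<open>The rows with \<open>0 < j < T\<close> require
      \<open>v 0 + \<delta> * v j = 1\<close>. With all \<open>v j\<close> equal to
      \<open>c\<close>, row \<open>T\<close> then requires
      \<open>(real T + \<delta>) * c = 1\<close>.\<close>
    define c where "c = 1 / (real T + \<delta>)"
    have c: "0 < c" "c \<le> 1" "\<delta> * c \<le> 1" "(real T + \<delta>) * c = 1"
      using T \<delta> by (auto simp: c_def field_simps)
    show ?thesis
    proof (rule that[of "\<lambda>m. if m = 0 then 1 - \<delta> * c else c"])
      show "\<bar>if m = 0 then 1 - \<delta> * c else c\<bar> \<le> 1" for m :: nat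
        using c \<delta> by (auto simp: abs_le_iff)
      fix j assume j: "j \<in> S"
      have split: "(\<Sum>m<T. node_coeff T \<delta> j m * (if m = 0 then 1 - \<delta> * c else c)) =
         node_coeff T \<delta> j 0 * (1 - \<delta> * c) + (\<Sum>m\<in>{1..<T}. node_coeff T \<delta> j m * c)"
        using T by (subst sum_lessThan_split_0) auto
      show "(\<Sum>m<T. node_coeff T \<delta> j m * (if m = 0 then 1 - \<delta> * c else c)) = 1"
      proof (cases "j = T")
        case True
        have "(\<Sum>m\<in>{1..<T}. node_coeff T \<delta> j m * c) = - (real T - 1) * \<delta> * c"
          using True T by (simp add: node_coeff_def of_nat_diff algebra_simps)
        moreover have "(1 + \<delta>) * (1 - \<delta> * c) + - (real T - 1) * \<delta> * c = 1 + \<delta> * (1 - (real T + \<delta>) * c)"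
          by (simp add: algebra_simps)
        ultimately show ?thesis using True c(4) unfolding split by (simp add: node_coeff_def)
      next
        case False
        hence "j < T" "0 < j" using notin[OF j] 3 by auto
        hence "(\<Sum>m\<in>{1..<T}. node_coeff T \<delta> j m * c) = (\<Sum>m\<in>{1..<T}. if m = j then \<delta> * c else 0)"
          by (intro sum.cong) (auto simp: node_coeff_def)
        also have "\<dots> = \<delta> * c" using \<open>j < T\<close> \<open>0 < j\<close> by simp
        finally show ?thesis unfolding split using \<open>j < T\<close> by (simp add: node_coeff_def)
      qed
    qed
  qed
qed

text \<open>Between nodes up to \<open>T\<close>, each entry is \<open>s\<close> plus a linear and a
  quadratic term in \<delta>, the shape needed to expand \<open>(\<eta> + K j l) ^ M\<close> to
  second order.\<close>

lemma node_covariance: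
  fixes s t \<delta> :: real
  assumes T: "0 < T"
  defines "\<tau> \<equiv> \<lambda>m::nat. if m = 0 then s else t"
  defines "K \<equiv> \<lambda>j l. \<Sum>m<T. node_coeff T \<delta> j m * node_coeff T \<delta> l m * \<tau> m"
  shows "j < T \<Longrightarrow> l < T \<Longrightarrow> K j l = s + (if j = l \<and> j \<noteq> 0 then \<delta> ^ 2 * t else 0)"
    "j < T \<Longrightarrow> K j T = s + \<delta> * s - (if j \<noteq> 0 then \<delta> ^ 2 * t else 0)"
    "j < T \<Longrightarrow> K T j = s + \<delta> * s - (if j \<noteq> 0 then \<delta> ^ 2 * t else 0)"
    "K T T = s + ((2 * \<delta> + \<delta> ^ 2) * s + \<delta> ^ 2 * (real T - 1) * t)"
    "T < l \<Longrightarrow> K j l = 0" "T < j \<Longrightarrow> K j l = 0"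
proof -
  have K: "K j l = node_coeff T \<delta> j 0 * node_coeff T \<delta> l 0 * s +
      (\<Sum>m\<in>{1..<T}. node_coeff T \<delta> j m * node_coeff T \<delta> l m * t)" for j l
    unfolding K_def \<tau>_def using T by (subst sum_lessThan_split_0) auto
  show "K j l = s + (if j = l \<and> j \<noteq> 0 then \<delta> ^ 2 * t else 0)" if "j < T" "l < T"
  proof -
    have "(\<Sum>m\<in>{1..<T}. node_coeff T \<delta> j m * node_coeff T \<delta> l m * t) =
        (\<Sum>m\<in>{1..<T}. if m = j then (if j = l then \<delta> ^ 2 * t else 0) else 0)"
      using that by (intro sum.cong) (auto simp: node_coeff_def power2_eq_square)
    also have "\<dots> = (if j = l \<and> j \<noteq> 0 then \<delta> ^ 2 * t else 0)" using that by auto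
    finally show ?thesis unfolding K using that by (simp add: node_coeff_def)
  qed
  show KjT: "K j T = s + \<delta> * s - (if j \<noteq> 0 then \<delta> ^ 2 * t else 0)" if "j < T" for j
  proof -
    have "(\<Sum>m\<in>{1..<T}. node_coeff T \<delta> j m * node_coeff T \<delta> T m * t) =
        (\<Sum>m\<in>{1..<T}. if m = j then - (\<delta> ^ 2 * t) else 0)"
      using that by (intro sum.cong) (auto simp: node_coeff_def power2_eq_square)
    also have "\<dots> = - (if j \<noteq> 0 then \<delta> ^ 2 * t else 0)" using that by auto
    finally show ?thesis unfolding K using that by (simp add: node_coeff_def algebra_simps)
  qed
  have sym: "K j l = K l j" for j l unfolding K_def by (simp add: mult_ac)
  show "K T j = s + \<delta> * s - (if j \<noteq> 0 then \<delta> ^ 2 * t else 0)" if "j < T"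
    using KjT[OF that] sym by simp
  have "(\<Sum>m\<in>{1..<T}. node_coeff T \<delta> T m * node_coeff T \<delta> T m * t) = \<delta> ^ 2 * (real T - 1) * t"
    using T by (simp add: node_coeff_def of_nat_diff power2_eq_square)
  thus "K T T = s + ((2 * \<delta> + \<delta> ^ 2) * s + \<delta> ^ 2 * (real T - 1) * t)"
    unfolding K by (simp add: node_coeff_def algebra_simps power2_eq_square)
  show "K j l = 0" if "T < l" using that by (simp add: K_def node_coeff_def)
  show "K j l = 0" if "T < j" using that by (simp add: K_def node_coeff_def)
qed

section \<open>Limit of the error for small \<delta>\<close>

text \<open>\<open>B\<close> has at most six different entries. The terms are grouped into
  differences whose quotients converge, although the decoder weights grow like 1 over
  \<delta>.\<close>

lemma decoder_quadratic_form:
  fixes B :: "nat \<Rightarrow> nat \<Rightarrow> real"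
  assumes T: "0 < T"
    and low: "\<And>j l. j < T \<Longrightarrow> l < T \<Longrightarrow> B j l = (if j = l \<and> j \<noteq> 0 then ekk else e0)"
    and jT: "\<And>j. j < T \<Longrightarrow> B j T = (if j \<noteq> 0 then ekT else eT)"
      "\<And>j. j < T \<Longrightarrow> B T j = (if j \<noteq> 0 then ekT else eT)"
    and TT: "B T T = eTT"
    and top: "\<And>j. B j (T + 1) = h" "\<And>l. B (T + 1) l = h"
  shows "(\<Sum>j\<le>T + 1. \<Sum>l\<le>T + 1. decoder T \<delta> a b j * decoder T \<delta> a b l * B j l) =
     a ^ 2 * e0 + 2 * a * b * ((eT - e0) / \<delta>)
     + b ^ 2 * ((real T - 1) * ((ekk - e0) / \<delta> ^ 2) + 2 * (real T - 1) * ((ekT - eT) / \<delta> ^ 2)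
         + (eTT - 2 * eT + e0) / \<delta> ^ 2) - 2 * a * h + h"
proof -
  define x where "x = b / \<delta>"
  define D where "D = decoder T \<delta> a b"
  have split: "(\<Sum>j\<le>T + 1. f j) = f 0 + (\<Sum>j\<in>{1..<T}. f j) + f T + f (T + 1)" for f :: "nat \<Rightarrow> real"
    using sum_lessThan_split_0[OF T, of f] by (simp add: lessThan_Suc_atMost[symmetric])
  have D: "D 0 = a - real T * x" "D T = x" "D (T + 1) = -1" "\<And>k. k \<in> {1..<T} \<Longrightarrow> D k = x"
    using T by (auto simp: D_def decoder_def x_def)
  have const: "(\<Sum>l\<in>{1..<T}. y) = (real T - 1) * y" for y :: real using T by (simp add: of_nat_diff)
  have row: "(\<Sum>l\<le>T + 1. D j * D l * B j l) =
      D j * ((a - real T * x) * B j 0 + x * (\<Sum>l\<in>{1..<T}. B j l) + x * B j T - B j (T + 1))" for j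
  proof -
    have "(\<Sum>l\<in>{1..<T}. D j * D l * B j l) = D j * x * (\<Sum>l\<in>{1..<T}. B j l)"
      unfolding sum_distrib_left by (intro sum.cong refl) (simp add: D(4))
    thus ?thesis unfolding split D(1,2,3) by (simp add: algebra_simps)
  qed
  have row0: "(\<Sum>l\<in>{1..<T}. B 0 l) = (real T - 1) * e0"
    using T low unfolding const[symmetric] by (intro sum.cong) auto
  have rowT: "(\<Sum>l\<in>{1..<T}. B T l) = (real T - 1) * ekT"
    using jT unfolding const[symmetric] by (intro sum.cong) auto
  have rowS: "(\<Sum>l\<in>{1..<T}. B (T + 1) l) = (real T - 1) * h"
    using top unfolding const[symmetric] by (intro sum.cong) auto
  \<comment> \<open>This segment of the row has one diagonal and \<open>T - 2\<close> off-diagonal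
    entries.\<close>
  have rowk: "(\<Sum>l\<in>{1..<T}. B k l) = ekk + (real T - 2) * e0" if k: "k \<in> {1..<T}" for k
  proof -
    have "(\<Sum>l\<in>{1..<T}. B k l) = (\<Sum>l\<in>{1..<T}. (if l = k then ekk - e0 else 0) + e0)"
      using k low by (intro sum.cong) auto
    also have "\<dots> = (ekk - e0) + (real T - 1) * e0" using k unfolding sum.distrib const by simp
    finally show ?thesis by (simp add: algebra_simps)
  qed
  have "(\<Sum>j\<in>{1..<T}. \<Sum>l\<le>T + 1. D j * D l * B j l) =
      (\<Sum>j\<in>{1..<T}. x * ((a - real T * x) * e0 + x * (ekk + (real T - 2) * e0) + x * ekT - h))"
    unfolding row
  proof (intro sum.cong refl)
    fix j assume j: "j \<in> {1..<T}"
    hence "B j 0 = e0" "B j T = ekT" using low[of j 0] jT(1)[of j] T by auto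
    thus "D j * ((a - real T * x) * B j 0 + x * (\<Sum>l\<in>{1..<T}. B j l) + x * B j T - B j (T + 1)) =
        x * ((a - real T * x) * e0 + x * (ekk + (real T - 2) * e0) + x * ekT - h)"
      unfolding rowk[OF j] top D(4)[OF j] by simp
  qed
  also have "\<dots> = (real T - 1) * (x * ((a - real T * x) * e0 + x * (ekk + (real T - 2) * e0) + x * ekT - h))"
    by (rule const)
  finally have mid: "(\<Sum>j\<in>{1..<T}. \<Sum>l\<le>T + 1. D j * D l * B j l) = \<dots>" .
  have "(\<Sum>j\<le>T + 1. \<Sum>l\<le>T + 1. D j * D l * B j l) =
      (\<Sum>l\<le>T + 1. D 0 * D l * B 0 l) + (\<Sum>j\<in>{1..<T}. \<Sum>l\<le>T + 1. D j * D l * B j l)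
      + (\<Sum>l\<le>T + 1. D T * D l * B T l) + (\<Sum>l\<le>T + 1. D (T + 1) * D l * B (T + 1) l)"
    by (rule split)
  also have "\<dots> = a ^ 2 * e0 + 2 * a * x * (eT - e0)
     + x ^ 2 * ((real T - 1) * (ekk - e0) + 2 * (real T - 1) * (ekT - eT) + (eTT - 2 * eT + e0)) - 2 * a * h + h"
    unfolding mid unfolding row unfolding row0 rowT rowS D(1,2,3) TT top low[OF T T] jT[OF T]
    by (simp add: algebra_simps power2_eq_square)
  also have "\<dots> = a ^ 2 * e0 + 2 * a * b * ((eT - e0) / \<delta>)
     + b ^ 2 * ((real T - 1) * ((ekk - e0) / \<delta> ^ 2) + 2 * (real T - 1) * ((ekT - eT) / \<delta> ^ 2)
         + (eTT - 2 * eT + e0) / \<delta> ^ 2) - 2 * a * h + h"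
    by (simp add: x_def power_divide add_divide_distrib distrib_left)
  finally show ?thesis unfolding D_def .
qed

text \<open>Insert \<open>\<delta> * (\<alpha> + \<beta> * \<delta>)\<close> for \<open>h\<close> in
  the expansion: once the constant and the term linear in \<delta> are removed, a factor
  \<open>\<delta> ^ 2\<close> splits off.\<close>

lemma power_quadratic_perturbation_tendsto:
  fixes q \<alpha> \<beta> :: real
  assumes M: "M = n + 2"
  shows "((\<lambda>\<delta>. ((q + (\<alpha> * \<delta> + \<beta> * \<delta> ^ 2)) ^ M - q ^ M - real M * q ^ (n + 1) * \<alpha> * \<delta>) / \<delta> ^ 2)
     \<longlongrightarrow> real M * q ^ (n + 1) * \<beta> + real ((n + 1) * (n + 2)) / 2 * q ^ n * \<alpha> ^ 2) (at_right 0)"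
proof -
  obtain \<psi> where \<psi>: "continuous_on UNIV \<psi>" "\<And>h. (q + h) ^ M =
     q ^ M + real M * q ^ (n + 1) * h + real ((n + 1) * (n + 2)) / 2 * q ^ n * h ^ 2 + h ^ 3 * \<psi> h"
    using power_add_Taylor2[of q n] M by auto
  define c where "c = real ((n + 1) * (n + 2)) / 2 * q ^ n"
  let ?f = "\<lambda>\<delta>. real M * q ^ (n + 1) * \<beta> + c * (\<alpha> + \<beta> * \<delta>) ^ 2
       + \<delta> * (\<alpha> + \<beta> * \<delta>) ^ 3 * \<psi> (\<alpha> * \<delta> + \<beta> * \<delta> ^ 2)"
  have \<psi>0: "isCont \<psi> 0" using \<psi>(1) by (simp add: continuous_on_eq_continuous_at)
  have "((\<lambda>\<delta>. \<alpha> * \<delta> + \<beta> * \<delta> ^ 2) \<longlongrightarrow> \<alpha> * 0 + \<beta> * 0 ^ 2) (at_right 0)"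
    by (intro tendsto_intros)
  hence "((\<lambda>\<delta>. \<psi> (\<alpha> * \<delta> + \<beta> * \<delta> ^ 2)) \<longlongrightarrow> \<psi> 0) (at_right 0)"
    by (intro isCont_tendsto_compose[OF \<psi>0]) simp
  hence "(?f \<longlongrightarrow> real M * q ^ (n + 1) * \<beta> + c * (\<alpha> + \<beta> * 0) ^ 2 + 0 * (\<alpha> + \<beta> * 0) ^ 3 * \<psi> 0) (at_right 0)"
    by (intro tendsto_intros)
  hence lim: "(?f \<longlongrightarrow> real M * q ^ (n + 1) * \<beta> + c * \<alpha> ^ 2) (at_right 0)" by simp
  have "?f \<delta> = ((q + (\<alpha> * \<delta> + \<beta> * \<delta> ^ 2)) ^ M - q ^ M - real M * q ^ (n + 1) * \<alpha> * \<delta>) / \<delta> ^ 2"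
    if "\<delta> > 0" for \<delta>
  proof -
    have "(q + (\<alpha> * \<delta> + \<beta> * \<delta> ^ 2)) ^ M - q ^ M - real M * q ^ (n + 1) * \<alpha> * \<delta> = ?f \<delta> * \<delta> ^ 2"
      unfolding \<psi>(2) c_def[symmetric] by algebra
    thus ?thesis using that by simp
  qed
  hence "eventually (\<lambda>\<delta>. ?f \<delta> =
      ((q + (\<alpha> * \<delta> + \<beta> * \<delta> ^ 2)) ^ M - q ^ M - real M * q ^ (n + 1) * \<alpha> * \<delta>) / \<delta> ^ 2) (at_right 0)"
    by (auto simp: eventually_at_filter)
  from Lim_transform_eventually[OF lim this] show ?thesis unfolding c_def .
qed

text \<open>The limit is the mean square error, at input variances \<eta>, of the estimate
  \<open>a\<close> times the product of the X_i plus \<open>b\<close> times the sum over i of the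
  noise z0_i times the product of the other X_k.\<close>

lemma decoder_quadratic_form_tendsto:
  fixes s t \<eta> a b :: real
  assumes T: "0 < T" and M: "M = n + 2"
  defines "q \<equiv> \<eta> + s"
  shows "((\<lambda>\<delta>. \<Sum>j\<le>T + 1. \<Sum>l\<le>T + 1. decoder T \<delta> a b j * decoder T \<delta> a b l *
       (\<eta> + (\<Sum>m<T. node_coeff T \<delta> j m * node_coeff T \<delta> l m * (if m = 0 then s else t))) ^ M)
     \<longlongrightarrow> a ^ 2 * q ^ M + 2 * a * b * (real M * q ^ (n + 1) * s)
       + b ^ 2 * (real M * q ^ (n + 1) * s + real ((n + 1) * (n + 2)) * q ^ n * s ^ 2)
       - 2 * a * \<eta> ^ M + \<eta> ^ M) (at_right 0)"
proof -
  \<comment> \<open>Every matrix entry between two nodes up to \<open>T\<close> is some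
    \<open>P \<alpha> \<beta> \<delta>\<close>.\<close>
  define P where "P \<alpha> \<beta> \<delta> = (q + (\<alpha> * \<delta> + \<beta> * \<delta> ^ 2)) ^ M" for \<alpha> \<beta> \<delta>
  define e1 where "e1 = real M * q ^ (n + 1)"
  define e2 where "e2 = real ((n + 1) * (n + 2)) / 2 * q ^ n"
  define c where "c = (real T - 1) * t"
  have second: "((\<lambda>\<delta>. (P \<alpha> \<beta> \<delta> - q ^ M - e1 * \<alpha> * \<delta>) / \<delta> ^ 2) \<longlongrightarrow> e1 * \<beta> + e2 * \<alpha> ^ 2) (at_right 0)" for \<alpha> \<beta>
    unfolding P_def e1_def e2_def by (rule power_quadratic_perturbation_tendsto[OF M])
  have pos: "eventually (\<lambda>\<delta>::real. 0 < \<delta>) (at_right 0)" by (simp add: eventually_at_filter)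
  have id: "((\<lambda>\<delta>::real. \<delta>) \<longlongrightarrow> 0) (at_right 0)" by (rule tendsto_ident_at)
  have L1: "((\<lambda>\<delta>. (P s 0 \<delta> - q ^ M) / \<delta>) \<longlongrightarrow> e1 * s) (at_right 0)"
  proof (rule Lim_transform_eventually)
    show "((\<lambda>\<delta>. \<delta> * ((P s 0 \<delta> - q ^ M - e1 * s * \<delta>) / \<delta> ^ 2) + e1 * s) \<longlongrightarrow> e1 * s) (at_right 0)"
      using tendsto_add[OF tendsto_mult[OF id second[of s 0]] tendsto_const[of "e1 * s"]] by simp
    show "eventually (\<lambda>\<delta>. \<delta> * ((P s 0 \<delta> - q ^ M - e1 * s * \<delta>) / \<delta> ^ 2) + e1 * s = (P s 0 \<delta> - q ^ M) / \<delta>) (at_right 0)"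
      using pos by eventually_elim (simp add: field_simps power2_eq_square)
  qed
  have L2: "((\<lambda>\<delta>. (P 0 t \<delta> - q ^ M) / \<delta> ^ 2) \<longlongrightarrow> e1 * t) (at_right 0)"
    using second[of 0 t] by simp
  have L3: "((\<lambda>\<delta>. (P s (- t) \<delta> - P s 0 \<delta>) / \<delta> ^ 2) \<longlongrightarrow> - e1 * t) (at_right 0)"
    using tendsto_diff[OF second[of s "- t"] second[of s 0]] by (simp add: diff_divide_distrib[symmetric])
  \<comment> \<open>A second difference: the linear terms cancel, and the quadratic ones leave
    \<open>(2 * s) ^ 2 - 2 * s ^ 2 = 2 * s ^ 2\<close>.\<close>
  have L4: "((\<lambda>\<delta>. (P (2 * s) (s + c) \<delta> - 2 * P s 0 \<delta> + q ^ M) / \<delta> ^ 2) \<longlongrightarrow> e1 * (s + c) + 2 * e2 * s ^ 2) (at_right 0)"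
  proof (rule Lim_transform_eventually)
    show "((\<lambda>\<delta>. (P (2 * s) (s + c) \<delta> - q ^ M - e1 * (2 * s) * \<delta>) / \<delta> ^ 2
        - 2 * ((P s 0 \<delta> - q ^ M - e1 * s * \<delta>) / \<delta> ^ 2)) \<longlongrightarrow> e1 * (s + c) + 2 * e2 * s ^ 2) (at_right 0)"
      by (rule tendsto_eq_rhs[OF tendsto_diff[OF second tendsto_mult[OF tendsto_const second]]])
         (simp add: power_mult_distrib)
    show "eventually (\<lambda>\<delta>. (P (2 * s) (s + c) \<delta> - q ^ M - e1 * (2 * s) * \<delta>) / \<delta> ^ 2
        - 2 * ((P s 0 \<delta> - q ^ M - e1 * s * \<delta>) / \<delta> ^ 2) = (P (2 * s) (s + c) \<delta> - 2 * P s 0 \<delta> + q ^ M) / \<delta> ^ 2) (at_right 0)"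
      using pos by eventually_elim (simp add: field_simps power2_eq_square)
  qed
  let ?F = "\<lambda>\<delta>. a ^ 2 * q ^ M + 2 * a * b * ((P s 0 \<delta> - q ^ M) / \<delta>)
     + b ^ 2 * ((real T - 1) * ((P 0 t \<delta> - q ^ M) / \<delta> ^ 2)
         + 2 * (real T - 1) * ((P s (- t) \<delta> - P s 0 \<delta>) / \<delta> ^ 2)
         + (P (2 * s) (s + c) \<delta> - 2 * P s 0 \<delta> + q ^ M) / \<delta> ^ 2) - 2 * a * \<eta> ^ M + \<eta> ^ M"
  have "(?F \<longlongrightarrow> a ^ 2 * q ^ M + 2 * a * b * (e1 * s)
     + b ^ 2 * ((real T - 1) * (e1 * t) + 2 * (real T - 1) * (- e1 * t) + (e1 * (s + c) + 2 * e2 * s ^ 2))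
     - 2 * a * \<eta> ^ M + \<eta> ^ M) (at_right 0)"
    by (intro tendsto_intros L1 L2 L3 L4)
  \<comment> \<open>The auxiliary variance disappears here, as \<open>t - 2 * t + t = 0\<close> with
    weight \<open>real T - 1\<close>.\<close>
  also have "(real T - 1) * (e1 * t) + 2 * (real T - 1) * (- e1 * t) + (e1 * (s + c) + 2 * e2 * s ^ 2) =
      e1 * s + 2 * e2 * s ^ 2"
    by (simp add: c_def algebra_simps)
  also have "2 * e2 * s ^ 2 = real ((n + 1) * (n + 2)) * q ^ n * s ^ 2" by (simp add: e2_def)
  also have "?F = (\<lambda>\<delta>. \<Sum>j\<le>T + 1. \<Sum>l\<le>T + 1. decoder T \<delta> a b j * decoder T \<delta> a b l *
       (\<eta> + (\<Sum>m<T. node_coeff T \<delta> j m * node_coeff T \<delta> l m * (if m = 0 then s else t))) ^ M)"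
  proof
    fix \<delta>
    define K where "K j l = (\<Sum>m<T. node_coeff T \<delta> j m * node_coeff T \<delta> l m * (if m = 0 then s else t))" for j l
    note cov = node_covariance[OF T, where s = s and t = t and \<delta> = \<delta>, folded K_def]
    show "?F \<delta> = (\<Sum>j\<le>T + 1. \<Sum>l\<le>T + 1. decoder T \<delta> a b j * decoder T \<delta> a b l *
       (\<eta> + (\<Sum>m<T. node_coeff T \<delta> j m * node_coeff T \<delta> l m * (if m = 0 then s else t))) ^ M)"
      unfolding K_def[symmetric]
      by (rule decoder_quadratic_form[OF T, symmetric])
         (auto simp: cov P_def q_def c_def algebra_simps)
  qed
  finally show ?thesis unfolding e1_def .
qed

text \<open>The coefficients come from \<open>A = r X + W\<close> with \<open>W = (1 - r) X - R\<close> uncorrelated to \<open>X = A + R\<close>: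
  the projection of \<open>\<Prod>A\<^sub>i\<close> is \<open>r\<^sup>M \<Prod>X\<^sub>i + r\<^bsup>M-1\<^esup> \<Sum>\<^sub>i W\<^sub>i \<Prod>\<^bsub>k \<noteq> i\<^esub> X\<^sub>k\<close>.\<close>

lemma optimal_decoder_value:
  fixes \<eta> s :: real
  assumes \<eta>: "0 < \<eta>" and s: "0 < s" and M: "M = n + 2"
  defines "q \<equiv> \<eta> + s" and "r \<equiv> \<eta> / (\<eta> + s)"
  defines "a \<equiv> r ^ M + real M * r ^ (M - 1) * (1 - r)" and "b \<equiv> - (r ^ (M - 1))"
  shows "a ^ 2 * q ^ M + 2 * a * b * (real M * q ^ (n + 1) * s)
       + b ^ 2 * (real M * q ^ (n + 1) * s + real ((n + 1) * (n + 2)) * q ^ n * s ^ 2)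
       - 2 * a * \<eta> ^ M + \<eta> ^ M =
     \<eta> ^ M * ((1 + \<eta> / s) ^ M - real M * (\<eta> / s) ^ (M - 1) - (\<eta> / s) ^ M) / (1 + \<eta> / s) ^ M"
proof -
  define m where "m = real n"
  \<comment> \<open>Making \<open>r ^ n\<close> and \<open>q ^ n\<close> atomic turns the claim into
    a polynomial identity.\<close>
  define R where "R = r ^ n"
  define Q where "Q = q ^ n"
  define c where "c = 1 - r"
  have q: "0 < q" using \<eta> s by (simp add: q_def)
  have \<eta>_eq: "\<eta> = r * q" using q by (simp add: r_def q_def)
  have s_eq: "s = c * q" using q by (simp add: c_def r_def q_def field_simps)
  have c: "c \<noteq> 0" using s s_eq by auto
  have rc: "r = 1 - c" by (simp add: c_def)
  have Mm: "real M = m + 2" by (simp add: M m_def)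
  have M1: "M - 1 = n + 1" by (simp add: M)
  have pw: "x ^ M = x ^ n * x ^ 2" for x :: real by (simp add: M power_add power2_eq_square)
  have S: "\<eta> / s = r / c" using q by (simp add: \<eta>_eq s_eq)
  have S1: "1 + \<eta> / s = 1 / c" unfolding S using c by (simp add: rc field_simps)
  have "\<eta> ^ M * ((1 + \<eta> / s) ^ M - real M * (\<eta> / s) ^ (M - 1) - (\<eta> / s) ^ M) / (1 + \<eta> / s) ^ M
     = \<eta> ^ M * (1 - real M * r ^ (M - 1) * c - r ^ M)"
  proof -
    have "(1 / c) ^ M \<noteq> 0" using c by simp
    moreover have "(r / c) ^ (M - 1) = (1 / c) ^ M * (r ^ (M - 1) * c)"
      unfolding M1 pw using c by (simp add: power_divide power2_eq_square)
    moreover have "(r / c) ^ M = (1 / c) ^ M * r ^ M" by (simp add: power_divide)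
    ultimately have "(1 / c) ^ M - real M * (r / c) ^ (M - 1) - (r / c) ^ M =
        (1 / c) ^ M * (1 - real M * r ^ (M - 1) * c - r ^ M)"
      by (simp add: algebra_simps)
    thus ?thesis unfolding S1 unfolding S using \<open>(1 / c) ^ M \<noteq> 0\<close> by simp
  qed
  also have "\<dots> = R * Q * r ^ 2 * q ^ 2 * (1 - (m + 2) * (R * r) * c - R * r ^ 2)"
    unfolding \<eta>_eq M1 Mm by (simp add: pw power_mult_distrib R_def Q_def)
  also have "\<dots> = a ^ 2 * q ^ M + 2 * a * b * (real M * q ^ (n + 1) * s)
       + b ^ 2 * (real M * q ^ (n + 1) * s + real ((n + 1) * (n + 2)) * q ^ n * s ^ 2)
       - 2 * a * \<eta> ^ M + \<eta> ^ M"
  proof -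
    have a: "a = R * r ^ 2 + (m + 2) * (R * r) * c" unfolding a_def M1 Mm by (simp add: pw R_def c_def)
    have b: "b = - (R * r)" unfolding b_def M1 by (simp add: R_def)
    have 1: "q ^ M = Q * q ^ 2" "q ^ (n + 1) = Q * q" "q ^ n = Q" by (simp_all add: pw Q_def)
    have 2: "\<eta> ^ M = R * Q * r ^ 2 * q ^ 2" unfolding \<eta>_eq by (simp add: pw power_mult_distrib R_def Q_def)
    have 3: "real ((n + 1) * (n + 2)) = (m + 1) * (m + 2)" by (simp add: m_def algebra_simps)
    \<comment> \<open>The identity without the common factor \<open>q ^ M\<close>; \<open>k\<close>
      is the number of inputs.\<close>
    have inner: "R * r ^ 2 * (1 - k * (R * r) * c - R * r ^ 2) =
        a ^ 2 + 2 * a * b * k * c + b ^ 2 * (k * c + (k - 1) * k * c ^ 2) - 2 * a * (R * r ^ 2) + R * r ^ 2"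
      if "k = m + 2" for k
      unfolding a b that[symmetric] c_def by (simp add: algebra_simps power2_eq_square)
    have "R * Q * r ^ 2 * q ^ 2 * (1 - (m + 2) * (R * r) * c - R * r ^ 2) =
        Q * q ^ 2 * (R * r ^ 2 * (1 - (m + 2) * (R * r) * c - R * r ^ 2))"
      by (simp only: mult_ac)
    also have "\<dots> = a ^ 2 * (Q * q ^ 2) + 2 * a * b * ((m + 2) * (Q * q) * (c * q))
       + b ^ 2 * ((m + 2) * (Q * q) * (c * q) + (m + 1) * (m + 2) * Q * (c * q) ^ 2)
       - 2 * a * (R * Q * r ^ 2 * q ^ 2) + R * Q * r ^ 2 * q ^ 2"
      unfolding inner[OF refl] by (simp add: algebra_simps power2_eq_square)
    finally show ?thesis unfolding 2 1 3 s_eq Mm .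
  qed
  finally show ?thesis by simp
qed

section \<open>Choice of the parameters\<close>

lemma sigma_star_sq_pos: "0 < \<epsilon> \<Longrightarrow> 0 < sigma_star_sq \<epsilon>"
  unfolding sigma_star_sq_def by (intro divide_pos_pos add_nonneg_pos) auto

lemma isCont_SNR_star:
  assumes "0 < \<epsilon>"
  shows "isCont (SNR_star \<eta>) \<epsilon>"
proof -
  have "isCont sigma_star_sq \<epsilon>"
    unfolding sigma_star_sq_def[abs_def] using assms by (intro continuous_intros) auto
  thus ?thesis
    unfolding SNR_star_def[abs_def] using sigma_star_sq_pos[OF assms] by (intro continuous_intros) auto
qed

theorem theorem3:
  fixes N T M :: nat and \<eta> \<epsilon> \<xi> :: real
  assumes "N > 0" "T > 0" "M > 0" "N = T + 1" "N < M" "\<eta> > 0" "\<epsilon> > 0" "\<xi> > 0"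
  shows "\<exists>(\<mu> :: nat \<Rightarrow> (nat \<Rightarrow> real) measure) (d :: nat \<Rightarrow> real).
           valid_noise N M \<mu> \<and> T_node_DP N T M \<epsilon> \<mu> \<and>
           LMSE N M \<eta> \<mu> d \<le> ennreal (\<eta> ^ M *
              ((1 + SNR_star \<eta> \<epsilon>) ^ M - real M * SNR_star \<eta> \<epsilon> ^ (M - 1) - SNR_star \<eta> \<epsilon> ^ M)
              / (1 + SNR_star \<eta> \<epsilon>) ^ M + \<xi>)"
proof -
  \<comment> \<open>\<open>M\<close> is at least 3 because \<open>T + 1 < M\<close> with positive
    \<open>T\<close>, so the subtraction is exact.\<close>
  define n where "n = M - 2"
  have M: "M = n + 2" using assms by (simp add: n_def)
  have T: "0 < T" by fact
  define L where "L e = \<eta> ^ M * ((1 + SNR_star \<eta> e) ^ M - real M * SNR_star \<eta> e ^ (M - 1) - SNR_star \<eta> e ^ M)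
      / (1 + SNR_star \<eta> e) ^ M" for e
  have "0 < SNR_star \<eta> \<epsilon>"
    using assms sigma_star_sq_pos by (simp add: SNR_star_def)
  hence "isCont L \<epsilon>"
    unfolding L_def[abs_def] using isCont_SNR_star[OF \<open>0 < \<epsilon>\<close>]
    by (intro continuous_intros) (auto simp: add_nonneg_eq_0_iff)
  \<comment> \<open>Continuity lets \<open>z 0\<close> use a budget \<epsilon>1 slightly below
    \<epsilon> at the price of half of \<xi>; the difference pays for the auxiliary noises.\<close>
  hence "(L \<longlongrightarrow> L \<epsilon>) (at_left \<epsilon>)"
    unfolding isCont_def by (rule filterlim_mono) (simp_all add: at_le)
  hence "eventually (\<lambda>e. L e < L \<epsilon> + \<xi> / 2) (at_left \<epsilon>)"
    using \<open>0 < \<xi>\<close> by (intro order_tendstoD) auto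
  moreover have "eventually (\<lambda>e. e \<in> {0<..<\<epsilon>}) (at_left \<epsilon>)"
    using \<open>0 < \<epsilon>\<close> by (rule eventually_at_left_real)
  ultimately have "eventually (\<lambda>e. L e < L \<epsilon> + \<xi> / 2 \<and> e \<in> {0<..<\<epsilon>}) (at_left \<epsilon>)"
    by (rule eventually_conj)
  then obtain \<epsilon>1 where \<epsilon>1: "L \<epsilon>1 < L \<epsilon> + \<xi> / 2" "0 < \<epsilon>1" "\<epsilon>1 < \<epsilon>"
    using eventually_happens'[OF trivial_limit_at_left_real] by auto
  \<comment> \<open>Only \<open>T - 1\<close> auxiliary noises share the difference; dividing by
    \<open>T\<close> also covers \<open>T = 1\<close>.\<close>
  define \<epsilon>2 where "\<epsilon>2 = (\<epsilon> - \<epsilon>1) / real T"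
  have \<epsilon>2: "0 < \<epsilon>2" using \<epsilon>1 T by (simp add: \<epsilon>2_def)
  obtain \<rho>1 where \<rho>1: "valid_input (sigma_star_sq \<epsilon>1) \<rho>1" "(\<integral>x. x ^ 2 \<partial>\<rho>1) = sigma_star_sq \<epsilon>1" "shift_private \<epsilon>1 \<rho>1"
    using noise_with_sigma_star_variance[OF \<epsilon>1(2)] .
  obtain \<rho>2 where \<rho>2: "valid_input (sigma_star_sq \<epsilon>2) \<rho>2" "(\<integral>x. x ^ 2 \<partial>\<rho>2) = sigma_star_sq \<epsilon>2" "shift_private \<epsilon>2 \<rho>2"
    using noise_with_sigma_star_variance[OF \<epsilon>2] .
  define s where "s = sigma_star_sq \<epsilon>1"
  \<comment> \<open>However large this variance is, it is fixed before \<delta> and absent from the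
    limit as \<delta> tends to 0.\<close>
  define t where "t = sigma_star_sq \<epsilon>2"
  have s: "0 < s" and t: "0 < t" using sigma_star_sq_pos \<epsilon>1 \<epsilon>2 by (auto simp: s_def t_def)
  define \<rho> where "\<rho> m = (if m = 0 then \<rho>1 else \<rho>2)" for m :: nat
  define \<tau> where "\<tau> m = (if m = 0 then s else t)" for m :: nat
  define e where "e m = (if m = 0 then \<epsilon>1 else \<epsilon>2)" for m :: nat
  have \<rho>: "valid_input (\<tau> m) (\<rho> m)" "(\<integral>x. x ^ 2 \<partial>\<rho> m) = \<tau> m" "shift_private (e m) (\<rho> m)" for m
    using \<rho>1 \<rho>2 by (auto simp: \<rho>_def \<tau>_def e_def s_def t_def)
  have prob: "prob_space (\<rho> m)" and sets_\<rho>: "sets (\<rho> m) = sets borel" for m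
    using \<rho>(1)[of m] by (auto simp: valid_input_def)
  have "(\<Sum>m<T. e m) = \<epsilon>1 + (real T - 1) * \<epsilon>2"
    unfolding sum_lessThan_split_0[OF T] using T by (simp add: e_def of_nat_diff)
  also have "\<dots> \<le> \<epsilon>1 + real T * \<epsilon>2" using \<epsilon>2 by (simp add: algebra_simps)
  also have "\<dots> = \<epsilon>" using T by (simp add: \<epsilon>2_def)
  finally have e_sum: "(\<Sum>m<T. e m) \<le> \<epsilon>" .

  define r where "r = \<eta> / (\<eta> + s)"
  define a where "a = r ^ M + real M * r ^ (M - 1) * (1 - r)"
  define b where "b = - (r ^ (M - 1))"
  define F where "F \<delta> = (\<Sum>j\<le>T + 1. \<Sum>l\<le>T + 1. decoder T \<delta> a b j * decoder T \<delta> a b l *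
       (\<eta> + (\<Sum>m<T. node_coeff T \<delta> j m * node_coeff T \<delta> l m * \<tau> m)) ^ M)" for \<delta>
  have "(F \<longlongrightarrow> L \<epsilon>1) (at_right 0)"
    using decoder_quadratic_form_tendsto[OF T M, of a b \<eta> s t]
    unfolding optimal_decoder_value[OF \<open>0 < \<eta>\<close> s M, folded r_def, folded a_def b_def]
    by (simp add: F_def[abs_def] \<tau>_def L_def SNR_star_def s_def)
  hence "eventually (\<lambda>\<delta>. F \<delta> < L \<epsilon>1 + \<xi> / 2) (at_right 0)"
    using \<open>0 < \<xi>\<close> by (intro order_tendstoD) auto
  moreover have "eventually (\<lambda>\<delta>::real. 0 < \<delta>) (at_right 0)" by (simp add: eventually_at_filter)
  ultimately have "eventually (\<lambda>\<delta>. F \<delta> < L \<epsilon>1 + \<xi> / 2 \<and> 0 < \<delta>) (at_right 0)"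
    by (rule eventually_conj)
  then obtain \<delta> where \<delta>: "F \<delta> < L \<epsilon>1 + \<xi> / 2" "0 < \<delta>"
    using eventually_happens'[OF trivial_limit_at_right_real] by auto
  define \<mu> where "\<mu> = (\<lambda>i::nat. linear_noise N T (node_coeff T \<delta>) \<rho>)"
  define d where "d = decoder T \<delta> a b"
  note mom = linear_noise_moments[where \<rho> = \<rho> and \<tau> = \<tau> and N = N and T = T and G = "node_coeff T \<delta>", OF \<rho>(1,2)]
  have valid: "valid_noise N M \<mu>"
    unfolding valid_noise_def \<mu>_def using mom(1-4) by blast
  have "T_node_DP N T M \<epsilon> \<mu>"
    unfolding T_node_DP_def
  proof (intro allI impI ballI, elim conjE)
    fix i :: nat and a0 a1 :: real and S :: "nat set" and B :: "(nat \<Rightarrow> real) set"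
    assume a: "\<bar>a0 - a1\<bar> \<le> 1" and S: "S \<subseteq> {..<N}" "card S = T" and B: "B \<in> sets (PiM S (\<lambda>_. borel))"
    obtain v where v: "\<And>m. \<bar>v m\<bar> \<le> 1" "\<And>j. j \<in> S \<Longrightarrow> (\<Sum>m<T. node_coeff T \<delta> j m * v m) = 1"
      using node_coeff_shift_direction[OF T \<delta>(2) S(1)[unfolded \<open>N = T + 1\<close>] S(2)] by blast
    let ?p = "\<lambda>c. measure (\<mu> i) {x \<in> space (\<mu> i). (\<lambda>j\<in>S. c + x j) \<in> B}"
    have "?p a0 \<le> exp (\<Sum>m<T. e m) * ?p a1"
      unfolding \<mu>_def by (rule linear_noise_private[OF prob sets_\<rho> \<rho>(3) S(1) v a B])
    also have "\<dots> \<le> exp \<epsilon> * ?p a1" using e_sum by (intro mult_right_mono) auto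
    finally show "?p a0 \<le> exp \<epsilon> * ?p a1" .
  qed
  moreover have "LMSE N M \<eta> \<mu> d \<le> ennreal (L \<epsilon> + \<xi>)"
    unfolding LMSE_def
  proof (rule SUP_least)
    fix \<nu> :: "nat \<Rightarrow> real measure"
    assume "\<nu> \<in> {\<nu>. \<forall>i<M. valid_input \<eta> (\<nu> i)}"
    hence \<nu>: "\<And>i. i < M \<Longrightarrow> valid_input \<eta> (\<nu> i)" by simp
    define K where "K j l = (\<Sum>m<T. node_coeff T \<delta> j m * node_coeff T \<delta> l m * \<tau> m)" for j l
    have "(\<integral>\<^sup>+\<omega>. ennreal (sq_error N M d \<omega>) \<partial>PiM {..<M} (\<lambda>i. \<nu> i \<Otimes>\<^sub>M \<mu> i)) =
        ennreal (\<Sum>j\<le>N. \<Sum>l\<le>N. d j * d l * (\<Prod>i<M. (\<integral>a. a ^ 2 \<partial>\<nu> i) + K j l))"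
    proof (rule expected_sq_error[OF \<nu> valid])
      show "integrable (\<mu> i) (\<lambda>x. x j * x l)" "(\<integral>x. x j * x l \<partial>\<mu> i) = K j l" if "j < N" "l < N" for i j l
        using mom(5,6)[OF that] by (auto simp: \<mu>_def K_def)
      \<comment> \<open>\<open>sq_error\<close> reads \<open>d\<close> only below \<open>N\<close>;
        the value at \<open>N\<close> encodes the target.\<close>
      show "K j N = 0" "K N j = 0" "d N = - 1" for j
        using \<open>N = T + 1\<close> by (auto simp: K_def node_coeff_def d_def decoder_def)
    qed
    also have "(\<Sum>j\<le>N. \<Sum>l\<le>N. d j * d l * (\<Prod>i<M. (\<integral>a. a ^ 2 \<partial>\<nu> i) + K j l)) \<le>
        (\<Sum>j\<le>N. \<Sum>l\<le>N. d j * d l * (\<eta> + K j l) ^ card {..<M})"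
      unfolding K_def
      by (rule Gram_product_form_mono[where g = "\<lambda>m j. node_coeff T \<delta> j m"])
         (use \<nu> s t in \<open>auto simp: valid_input_def \<tau>_def\<close>)
    also have "\<dots> = F \<delta>" by (simp add: F_def K_def d_def \<open>N = T + 1\<close>)
    also have "\<dots> \<le> L \<epsilon> + \<xi>" using \<delta>(1) \<epsilon>1(1) by simp
    finally show "(\<integral>\<^sup>+\<omega>. ennreal (sq_error N M d \<omega>) \<partial>PiM {..<M} (\<lambda>i. \<nu> i \<Otimes>\<^sub>M \<mu> i)) \<le> ennreal (L \<epsilon> + \<xi>)"
      by (simp add: ennreal_leI)
  qed
  ultimately show ?thesis using valid unfolding L_def by blast
qed

end
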